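(* Let $\mathcal{P}=\langle\Sigma\mid\mathcal{R}\rangle$ be a semigroup presentation, and suppose that the semigroup $S$ presented by $\mathcal{P}$ contains an idempotent. Then there is a word $w\in\Sigma^+$ such that the diagram group $G=\mathcal{D}(\mathcal{P},w)$ contains R. Thompson's group $F$ as a subgroup. Moreover, one can take for $w$ any word that represents an idempotent in $S$.
   Context: R. Thompson's group $F$ is the group, under composition, of all increasing continuous piecewise linear maps of $[0,1]$ onto itself whose singularities occur at finitely many dyadic points (points of the form $m/2^n$) and all of whose slopes are integer powers of $2$; it is isomorphic to the diagram group $\mathcal{D}(\langle x\mid xx=x\rangle,x)$. Diagram groups. A semigroup presentation $\mathcal{P}=\langle\Sigma\mid\mathcal{R}\rangle$ consists of an alphabet $\Sigma$ and a set $\mathcal{R}$ of pairs $(u,v)$ of non-empty words over $\Sigma$, written $u=v$; presentations are assumed anti-symmetric: if $(u=v)\in\mathcal{R}$ then $(v=u)\notin\mathcal{R}$. $\Sigma^+$ and $\Sigma^*$ are the free semigroup and free monoid on $\Sigma$. The semigroup presented by $\mathcal{P}$ is the quotient of $\Sigma^+$ by the smallest congruence containing $\mathcal{R}$. The graph $\Gamma(\mathcal{P})$ has vertex set $\Sigma^+$ and an edge $(p,u\to v,q)$ from $puq$ to $pvq$ for all $p,q\in\Sigma^*$ and all $u,v$ with $(u=v)\in\mathcal{R}$ or $(v=u)\in\mathcal{R}$; the inverse edge is $(p,v\to u,q)$. The Squier complex $\mathcal{K}(\mathcal{P})$ is the 2-complex obtained from $\Gamma(\mathcal{P})$ by attaching,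 for all $p,z,q\in\Sigma^*$ and $(\ell_1=r_1),(\ell_2=r_2)\in\mathcal{R}$, a 2-cell along the closed path $p_1p_2^{-1}$, where $p_1=(p,\ell_1\to r_1,z\ell_2q)(pr_1z,\ell_2\to r_2,q)$ and $p_2=(p\ell_1z,\ell_2\to r_2,q)(p,\ell_1\to r_1,zr_2q)$. For $w\in\Sigma^+$ the diagram group $\mathcal{D}(\mathcal{P},w)$ is (up to isomorphism, by Kilibarda's theorem; this may be taken as the definition) the fundamental group $\pi_1(\mathcal{K}(\mathcal{P}),w)$. *)

theory Defs
  imports Complex_Main "HOL-Algebra.Bij" "Graph_Theory.Arc_Walk"
begin

section \<open>Semigroup presentations\<close>

definition nonempty_words :: "'a set \<Rightarrow> 'a list set" where
  "nonempty_words \<Sigma> = lists \<Sigma> - {[]}"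

locale semigroup_presentation =
  fixes \<Sigma> :: "'a set" and R :: "('a list \<times> 'a list) set"
  assumes relations_words: "R \<subseteq> nonempty_words \<Sigma> \<times> nonempty_words \<Sigma>"
    and antisymmetric: "(u, v) \<in> R \<Longrightarrow> (v, u) \<notin> R"

definition semigroup_congruence :: "'a set \<Rightarrow> ('a list \<times> 'a list) set \<Rightarrow> bool" where
  "semigroup_congruence \<Sigma> E \<longleftrightarrow>
     equiv (nonempty_words \<Sigma>) E \<and>
     (\<forall>(u, v) \<in> E. \<forall>x \<in> nonempty_words \<Sigma>. (x @ u, x @ v) \<in> E \<and> (u @ x, v @ x) \<in> E)"

definition presentation_congruence ::
    "'a set \<Rightarrow> ('a list \<times> 'a list) set \<Rightarrow> ('a list \<times> 'a list) set" where
  "presentation_congruence \<Sigma> R = \<Inter>{E. semigroup_congruence \<Sigma> E \<and> R \<subseteq> E}"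

definition word_class :: "'a set \<Rightarrow> ('a list \<times> 'a list) set \<Rightarrow> 'a list \<Rightarrow> 'a list set" where
  "word_class \<Sigma> R w = presentation_congruence \<Sigma> R `` {w}"

definition presented_semigroup :: "'a set \<Rightarrow> ('a list \<times> 'a list) set \<Rightarrow> 'a list set set" where
  "presented_semigroup \<Sigma> R = nonempty_words \<Sigma> // presentation_congruence \<Sigma> R"

definition presented_mult ::
    "'a set \<Rightarrow> ('a list \<times> 'a list) set \<Rightarrow> 'a list set \<Rightarrow> 'a list set \<Rightarrow> 'a list set" where
  "presented_mult \<Sigma> R A B = (\<Union>a\<in>A. \<Union>b\<in>B. word_class \<Sigma> R (a @ b))"

definition is_idempotent :: "'a set \<Rightarrow> ('a list \<times> 'a list) set \<Rightarrow> 'a list set \<Rightarrow> bool" where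
  "is_idempotent \<Sigma> R e \<longleftrightarrow> e \<in> presented_semigroup \<Sigma> R \<and> presented_mult \<Sigma> R e e = e"


section \<open>The fundamental group of a combinatorial 2-complex\<close>

text \<open>
  A 2-complex is given by a directed graph \<open>G\<close> in which every arc \<open>e\<close> has an inverse arc
  \<open>arev e\<close>, and a set \<open>C\<close> of closed arc walks, the boundaries of the 2-cells.  Its fundamental
  group consists of the closed walks at a vertex modulo insertion and deletion of subwalks
  \<open>e (arev e)\<close> and of boundaries of 2-cells.  Inverses and cyclic shifts of boundaries can
  then be inserted and deleted as well.
\<close>

definition closed_walks :: "('v, 'e) pre_digraph \<Rightarrow> 'v \<Rightarrow> 'e list set" where
  "closed_walks G x = {p. pre_digraph.awalk G x p x}"

definition inverse_walk :: "('e \<Rightarrow> 'e) \<Rightarrow> 'e list \<Rightarrow> 'e list" where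
  "inverse_walk arev p = rev (map arev p)"

definition elementary_homotopy ::
    "('v, 'e) pre_digraph \<Rightarrow> ('e \<Rightarrow> 'e) \<Rightarrow> 'e list set \<Rightarrow> 'v \<Rightarrow> ('e list \<times> 'e list) set" where
  "elementary_homotopy G arev C x =
     {(p @ c @ q, p @ q) | p c q.
        p @ c @ q \<in> closed_walks G x \<and> p @ q \<in> closed_walks G x \<and>
        (c \<in> C \<or> (\<exists>e \<in> arcs G. c = [e, arev e]))}"

definition homotopy ::
    "('v, 'e) pre_digraph \<Rightarrow> ('e \<Rightarrow> 'e) \<Rightarrow> 'e list set \<Rightarrow> 'v \<Rightarrow> ('e list \<times> 'e list) set" where
  "homotopy G arev C x =
     (elementary_homotopy G arev C x \<union> (elementary_homotopy G arev C x)\<inverse>)\<^sup>*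
     \<inter> (closed_walks G x \<times> closed_walks G x)"

definition fundamental_group ::
    "('v, 'e) pre_digraph \<Rightarrow> ('e \<Rightarrow> 'e) \<Rightarrow> 'e list set \<Rightarrow> 'v \<Rightarrow> 'e list set monoid" where
  "fundamental_group G arev C x =
     \<lparr>carrier = closed_walks G x // homotopy G arev C x,
      mult = (\<lambda>A B. \<Union>a\<in>A. \<Union>b\<in>B. homotopy G arev C x `` {a @ b}),
      one = homotopy G arev C x `` {[]}\<rparr>"


section \<open>The Squier complex and diagram groups\<close>

text \<open>The tuple \<open>(p, u, v, q)\<close> stands for the edge \<open>(p, u \<rightarrow> v, q)\<close> from \<open>puq\<close> to \<open>pvq\<close>.\<close>

type_synonym 'a squier_edge = "'a list \<times> 'a list \<times> 'a list \<times> 'a list"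

definition squier_graph ::
    "'a set \<Rightarrow> ('a list \<times> 'a list) set \<Rightarrow> ('a list, 'a squier_edge) pre_digraph" where
  "squier_graph \<Sigma> R =
     \<lparr>verts = nonempty_words \<Sigma>,
      arcs = {(p, u, v, q). p \<in> lists \<Sigma> \<and> q \<in> lists \<Sigma> \<and> ((u, v) \<in> R \<or> (v, u) \<in> R)},
      tail = (\<lambda>(p, u, v, q). p @ u @ q),
      head = (\<lambda>(p, u, v, q). p @ v @ q)\<rparr>"

definition squier_inverse :: "'a squier_edge \<Rightarrow> 'a squier_edge" where
  "squier_inverse = (\<lambda>(p, u, v, q). (p, v, u, q))"

definition squier_cells ::
    "'a set \<Rightarrow> ('a list \<times> 'a list) set \<Rightarrow> 'a squier_edge list set" where
  "squier_cells \<Sigma> R =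
     {[(p, l1, r1, z @ l2 @ q), (p @ r1 @ z, l2, r2, q)] @
      inverse_walk squier_inverse [(p @ l1 @ z, l2, r2, q), (p, l1, r1, z @ r2 @ q)]
      | p z q l1 r1 l2 r2.
        p \<in> lists \<Sigma> \<and> z \<in> lists \<Sigma> \<and> q \<in> lists \<Sigma> \<and> (l1, r1) \<in> R \<and> (l2, r2) \<in> R}"

definition diagram_group ::
    "'a set \<Rightarrow> ('a list \<times> 'a list) set \<Rightarrow> 'a list \<Rightarrow> 'a squier_edge list set monoid" where
  "diagram_group \<Sigma> R w =
     fundamental_group (squier_graph \<Sigma> R) squier_inverse (squier_cells \<Sigma> R) w"


subsection \<open>Well-definedness of the quotient operations\<close>

lemma equiv_homotopy: "equiv (closed_walks G x) (homotopy G arev C x)"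
proof -
  let ?E = "elementary_homotopy G arev C x \<union> (elementary_homotopy G arev C x)\<inverse>"
  have "sym ?E" by (auto simp: sym_def)
  then have "sym (?E\<^sup>*)" by (rule sym_rtrancl)
  then show ?thesis
    unfolding homotopy_def equiv_def refl_on_def sym_def trans_def
    by (auto intro: rtrancl_trans)
qed

context wf_digraph begin

lemma closed_walks_append:
  "a \<in> closed_walks G x \<Longrightarrow> b \<in> closed_walks G x \<Longrightarrow> a @ b \<in> closed_walks G x"
  by (auto simp only: closed_walks_def mem_Collect_eq intro: awalk_appendI)

lemma elementary_homotopy_append:
  assumes "(a, a') \<in> elementary_homotopy G arev C x" "b \<in> closed_walks G x"
  shows "(a @ b, a' @ b) \<in> elementary_homotopy G arev C x"
    and "(b @ a, b @ a') \<in> elementary_homotopy G arev C x"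
proof -
  obtain p c q where pcq: "a = p @ c @ q" "a' = p @ q" "a \<in> closed_walks G x" "a' \<in> closed_walks G x"
    "c \<in> C \<or> (\<exists>e \<in> arcs G. c = [e, arev e])"
    using assms(1) unfolding elementary_homotopy_def by blast
  have "p @ c @ q @ b \<in> closed_walks G x" "p @ q @ b \<in> closed_walks G x"
    using closed_walks_append[OF pcq(3) assms(2)] closed_walks_append[OF pcq(4) assms(2)] pcq(1,2) by simp_all
  then show "(a @ b, a' @ b) \<in> elementary_homotopy G arev C x"
    unfolding elementary_homotopy_def mem_Collect_eq
    by (intro exI[of _ p] exI[of _ c] exI[of _ "q @ b"]) (simp only: pcq append.assoc simp_thms)
  have "(b @ p) @ c @ q \<in> closed_walks G x" "(b @ p) @ q \<in> closed_walks G x"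
    using closed_walks_append[OF assms(2) pcq(3)] closed_walks_append[OF assms(2) pcq(4)] pcq(1,2) by simp_all
  then show "(b @ a, b @ a') \<in> elementary_homotopy G arev C x"
    unfolding elementary_homotopy_def mem_Collect_eq
    by (intro exI[of _ "b @ p"] exI[of _ c] exI[of _ q]) (simp only: pcq append.assoc simp_thms)
qed

lemma homotopy_append_aux:
  assumes "(a, a') \<in> (elementary_homotopy G arev C x \<union> (elementary_homotopy G arev C x)\<inverse>)\<^sup>*"
    and "b \<in> closed_walks G x"
  shows "(a @ b, a' @ b) \<in> (elementary_homotopy G arev C x \<union> (elementary_homotopy G arev C x)\<inverse>)\<^sup>* \<and>
         (b @ a, b @ a') \<in> (elementary_homotopy G arev C x \<union> (elementary_homotopy G arev C x)\<inverse>)\<^sup>*"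
  using assms(1)
proof (induction rule: rtrancl_induct)
  case (step y z)
  then have "(y @ b, z @ b) \<in> elementary_homotopy G arev C x \<union> (elementary_homotopy G arev C x)\<inverse>"
    "(b @ y, b @ z) \<in> elementary_homotopy G arev C x \<union> (elementary_homotopy G arev C x)\<inverse>"
    using elementary_homotopy_append[OF _ assms(2)] by auto
  with step.IH show ?case by (meson rtrancl.rtrancl_into_rtrancl)
qed auto

lemma homotopy_append:
  assumes "(a, a') \<in> homotopy G arev C x" "(b, b') \<in> homotopy G arev C x"
  shows "(a @ b, a' @ b') \<in> homotopy G arev C x"
proof -
  have cl: "a \<in> closed_walks G x" "a' \<in> closed_walks G x" "b \<in> closed_walks G x" "b' \<in> closed_walks G x"
    using assms by (auto simp: homotopy_def)
  have "(a @ b, a' @ b) \<in> (elementary_homotopy G arev C x \<union> (elementary_homotopy G arev C x)\<inverse>)\<^sup>*"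
    using homotopy_append_aux assms(1) cl(3) unfolding homotopy_def by blast
  moreover have "(a' @ b, a' @ b') \<in> (elementary_homotopy G arev C x \<union> (elementary_homotopy G arev C x)\<inverse>)\<^sup>*"
    using homotopy_append_aux assms(2) cl(2) unfolding homotopy_def by blast
  ultimately show ?thesis
    using cl closed_walks_append unfolding homotopy_def by (auto intro: rtrancl_trans)
qed

lemma fundamental_group_mult:
  assumes "a \<in> closed_walks G x" "b \<in> closed_walks G x"
  shows "homotopy G arev C x `` {a} \<otimes>\<^bsub>fundamental_group G arev C x\<^esub> homotopy G arev C x `` {b}
       = homotopy G arev C x `` {a @ b}"
proof -
  let ?H = "homotopy G arev C x"
  have "?H `` {a' @ b'} = ?H `` {a @ b}" if "a' \<in> ?H `` {a}" "b' \<in> ?H `` {b}" for a' b'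
    using homotopy_append[of a a' arev C x b b'] that equiv_class_eq[OF equiv_homotopy] by fastforce
  moreover have "a \<in> ?H `` {a}" "b \<in> ?H `` {b}"
    using assms equiv_class_self[OF equiv_homotopy] by auto
  ultimately have "(\<Union>a'\<in>?H `` {a}. \<Union>b'\<in>?H `` {b}. ?H `` {a' @ b'}) = ?H `` {a @ b}"
    by blast
  then show ?thesis by (simp add: fundamental_group_def)
qed

lemma awalk_inverse_walk:
  assumes "\<And>e. e \<in> arcs G \<Longrightarrow> arev e \<in> arcs G \<and> tail G (arev e) = head G e \<and> head G (arev e) = tail G e"
  shows "awalk u p v \<Longrightarrow> awalk v (inverse_walk arev p) u"
proof (induction p arbitrary: u)
  case Nil then show ?case by (auto simp: inverse_walk_def awalk_Nil_iff)
next
  case (Cons e p)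
  then have "awalk v (inverse_walk arev p) (head G e)" "awalk (head G e) [arev e] u"
    using assms[of e] by (auto simp: awalk_simps)
  then have "awalk v (inverse_walk arev p @ [arev e]) u" by (rule awalk_appendI)
  then show ?case by (simp add: inverse_walk_def)
qed

lemma homotopy_inverse_walk:
  assumes "\<And>e. e \<in> arcs G \<Longrightarrow> arev e \<in> arcs G \<and> tail G (arev e) = head G e \<and> head G (arev e) = tail G e"
    and "x \<in> verts G"
  shows "awalk x p v \<Longrightarrow> (p @ inverse_walk arev p, []) \<in> homotopy G arev C x"
proof (induction p arbitrary: v rule: rev_induct)
  case Nil
  then show ?case using assms(2) equiv_class_self[OF equiv_homotopy, of "[]"]
    by (auto simp: inverse_walk_def homotopy_def closed_walks_def awalk_Nil_iff)
next
  case (snoc e p)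
  then have p: "awalk x p (tail G e)" "e \<in> arcs G" by (auto simp: awalk_simps)
  have "p @ [e, arev e] @ inverse_walk arev p \<in> closed_walks G x"
    using awalk_appendI[OF snoc.prems awalk_inverse_walk[OF assms(1) snoc.prems]]
    by (simp add: closed_walks_def inverse_walk_def)
  moreover have "p @ inverse_walk arev p \<in> closed_walks G x"
    using awalk_appendI[OF p(1) awalk_inverse_walk[OF assms(1) p(1)]] by (simp add: closed_walks_def)
  ultimately have "(p @ [e, arev e] @ inverse_walk arev p, p @ inverse_walk arev p) \<in> elementary_homotopy G arev C x"
    using p(2) unfolding elementary_homotopy_def mem_Collect_eq
    by (intro exI[of _ p] exI[of _ "[e, arev e]"] exI[of _ "inverse_walk arev p"]) blast
  then have "((p @ [e]) @ inverse_walk arev (p @ [e]), p @ inverse_walk arev p) \<in> homotopy G arev C x"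
    
    unfolding homotopy_def using
      \<open>p @ [e, arev e] @ inverse_walk arev p \<in> closed_walks G x\<close>
      \<open>p @ inverse_walk arev p \<in> closed_walks G x\<close>
    by (simp add: inverse_walk_def r_into_rtrancl)
  then show ?case using snoc.IH[OF p(1)] equiv_homotopy[of G x arev C] unfolding equiv_def trans_def by blast
qed

lemma group_fundamental_group:
  assumes inv: "\<And>e. e \<in> arcs G \<Longrightarrow> arev e \<in> arcs G \<and> tail G (arev e) = head G e \<and> head G (arev e) = tail G e \<and> arev (arev e) = e"
    and "x \<in> verts G"
  shows "group (fundamental_group G arev C x)"
proof -
  let ?H = "homotopy G arev C x" and ?G = "fundamental_group G arev C x"
  have car: "A \<in> carrier ?G \<longleftrightarrow> (\<exists>a \<in> closed_walks G x. A = ?H `` {a})" for A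
    by (auto simp: fundamental_group_def quotient_def)
  have nil: "[] \<in> closed_walks G x" using assms(2) by (simp add: closed_walks_def awalk_Nil_iff)
  have one: "\<one>\<^bsub>?G\<^esub> = ?H `` {[]}" by (simp add: fundamental_group_def)
  show ?thesis
  proof (rule groupI)
    show "\<one>\<^bsub>?G\<^esub> \<in> carrier ?G" using nil one car by blast
  next
    fix A B assume "A \<in> carrier ?G" "B \<in> carrier ?G"
    then show "A \<otimes>\<^bsub>?G\<^esub> B \<in> carrier ?G"
      using car closed_walks_append fundamental_group_mult by metis
  next
    fix A B D assume ABD: "A \<in> carrier ?G" "B \<in> carrier ?G" "D \<in> carrier ?G"
    obtain a where "a \<in> closed_walks G x" "A = ?H `` {a}" using ABD(1) car[of A] by blast
    moreover obtain b where "b \<in> closed_walks G x" "B = ?H `` {b}" using ABD(2) car[of B] by blast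
    moreover obtain d where "d \<in> closed_walks G x" "D = ?H `` {d}" using ABD(3) car[of D] by blast
    ultimately show "A \<otimes>\<^bsub>?G\<^esub> B \<otimes>\<^bsub>?G\<^esub> D = A \<otimes>\<^bsub>?G\<^esub> (B \<otimes>\<^bsub>?G\<^esub> D)"
      by (simp only: fundamental_group_mult closed_walks_append append.assoc)
  next
    fix A assume "A \<in> carrier ?G"
    then obtain a where a: "a \<in> closed_walks G x" "A = ?H `` {a}" using car[of A] by blast
    show "\<one>\<^bsub>?G\<^esub> \<otimes>\<^bsub>?G\<^esub> A = A" using a nil one fundamental_group_mult[of "[]" x a] by simp
    let ?b = "inverse_walk arev a"
    have aw: "awalk x a x" using a by (simp add: closed_walks_def)
    then have bw: "awalk x ?b x" using awalk_inverse_walk inv by blast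
    have "map (arev \<circ> arev) a = a" using aw inv by (intro map_idI) (auto simp: awalk_def)
    then have "inverse_walk arev ?b = a" by (simp add: inverse_walk_def rev_map)
    then have h: "(?b @ a, []) \<in> ?H" using homotopy_inverse_walk[OF _ assms(2) bw] inv by metis
    have "?H `` {?b @ a} = \<one>\<^bsub>?G\<^esub>" using equiv_class_eq[OF equiv_homotopy h] one by simp
    then have "?H `` {?b} \<otimes>\<^bsub>?G\<^esub> A = \<one>\<^bsub>?G\<^esub>"
      using fundamental_group_mult[of ?b x a] a bw by (simp add: closed_walks_def)
    moreover have "?H `` {?b} \<in> carrier ?G" using car[of "?H `` {?b}"] bw unfolding closed_walks_def by blast
    ultimately show "\<exists>B \<in> carrier ?G. B \<otimes>\<^bsub>?G\<^esub> A = \<one>\<^bsub>?G\<^esub>" by blast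
  qed
qed

end

context semigroup_presentation begin

lemma wf_squier_graph: "wf_digraph (squier_graph \<Sigma> R)"
proof -
  have "u \<in> lists \<Sigma> \<and> u \<noteq> [] \<and> v \<in> lists \<Sigma> \<and> v \<noteq> []" if "(u, v) \<in> R" for u v
    using that relations_words by (auto simp: nonempty_words_def)
  then show ?thesis by unfold_locales (fastforce simp: squier_graph_def nonempty_words_def)+
qed

lemma group_diagram_group:
  assumes "w \<in> nonempty_words \<Sigma>"
  shows "group (diagram_group \<Sigma> R w)"
  unfolding diagram_group_def using assms
  by (intro wf_digraph.group_fundamental_group[OF wf_squier_graph])
    (auto simp: squier_graph_def squier_inverse_def)

lemma squier_cells_closed:
  assumes "c \<in> squier_cells \<Sigma> R"
  shows "\<exists>x. c \<in> closed_walks (squier_graph \<Sigma> R) x"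
proof -
  interpret wf_digraph "squier_graph \<Sigma> R" by (rule wf_squier_graph)
  have R: "u \<in> lists \<Sigma> \<and> u \<noteq> [] \<and> v \<in> lists \<Sigma> \<and> v \<noteq> []" if "(u, v) \<in> R" for u v
    using that relations_words by (auto simp: nonempty_words_def)
  obtain p z q l1 r1 l2 r2 where c:
    "c = [(p, l1, r1, z @ l2 @ q), (p @ r1 @ z, l2, r2, q)] @
         inverse_walk squier_inverse [(p @ l1 @ z, l2, r2, q), (p, l1, r1, z @ r2 @ q)]"
    "p \<in> lists \<Sigma>" "z \<in> lists \<Sigma>" "q \<in> lists \<Sigma>" "(l1, r1) \<in> R" "(l2, r2) \<in> R"
    using assms unfolding squier_cells_def by blast
  have "c \<in> closed_walks (squier_graph \<Sigma> R) (p @ l1 @ z @ l2 @ q)"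
    unfolding c(1) closed_walks_def
    by (simp add: awalk_simps inverse_walk_def squier_inverse_def)
      (use c(2-) R[OF c(5)] R[OF c(6)] in \<open>simp add: squier_graph_def nonempty_words_def\<close>)
  then show ?thesis by blast
qed

lemma semigroup_congruence_presentation: "semigroup_congruence \<Sigma> (presentation_congruence \<Sigma> R)"
proof -
  let ?W = "nonempty_words \<Sigma>"
  let ?A = "{E. semigroup_congruence \<Sigma> E \<and> R \<subseteq> E}"
  have "semigroup_congruence \<Sigma> (?W \<times> ?W)"
    by (auto simp: semigroup_congruence_def equiv_def refl_on_def sym_def trans_def nonempty_words_def)
  then have ne: "?W \<times> ?W \<in> ?A" using relations_words by blast
  have sub: "\<Inter>?A \<subseteq> ?W \<times> ?W" using ne by blast
  have "equiv ?W (\<Inter>?A)"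
  proof (rule equivI)
    show "\<Inter>?A \<subseteq> ?W \<times> ?W" by (rule sub)
    show "refl_on ?W (\<Inter>?A)" using sub by (auto simp: refl_on_def semigroup_congruence_def equiv_def)
    show "sym (\<Inter>?A)" by (auto simp: sym_def semigroup_congruence_def equiv_def)
    have "trans E" if "E \<in> ?A" for E
      using that by (simp add: semigroup_congruence_def equiv_def)
    then show "trans (\<Inter>?A)" using trans_INTER[of ?A "\<lambda>E. E"] by simp
  qed
  moreover have "(x @ u, x @ v) \<in> \<Inter>?A \<and> (u @ x, v @ x) \<in> \<Inter>?A"
    if "(u, v) \<in> \<Inter>?A" "x \<in> ?W" for u v x
  proof -
    have "(x @ u, x @ v) \<in> E \<and> (u @ x, v @ x) \<in> E" if "E \<in> ?A" for E
      using that \<open>(u, v) \<in> \<Inter>?A\<close> \<open>x \<in> ?W\<close> unfolding semigroup_congruence_def by blast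
    then show ?thesis by blast
  qed
  ultimately show ?thesis
    unfolding presentation_congruence_def semigroup_congruence_def[of _ "\<Inter>?A"] by blast
qed

lemma presented_mult_word_class:
  assumes "u \<in> nonempty_words \<Sigma>" "v \<in> nonempty_words \<Sigma>"
  shows "presented_mult \<Sigma> R (word_class \<Sigma> R u) (word_class \<Sigma> R v) = word_class \<Sigma> R (u @ v)"
proof -
  let ?E = "presentation_congruence \<Sigma> R"
  have eq: "equiv (nonempty_words \<Sigma>) ?E"
    and c: "\<And>a b x. (a, b) \<in> ?E \<Longrightarrow> x \<in> nonempty_words \<Sigma> \<Longrightarrow> (x @ a, x @ b) \<in> ?E \<and> (a @ x, b @ x) \<in> ?E"
    using semigroup_congruence_presentation unfolding semigroup_congruence_def by blast+
  have "?E `` {a @ b} = ?E `` {u @ v}" if "(u, a) \<in> ?E" "(v, b) \<in> ?E" for a b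
  proof -
    have "a \<in> nonempty_words \<Sigma>" using eq that(1) by (meson equiv_class_eq_iff)
    then have "(a @ v, a @ b) \<in> ?E" "(u @ v, a @ v) \<in> ?E" using c that assms by blast+
    then show ?thesis using equiv_class_eq[OF eq] by metis
  qed
  moreover have "(u, u) \<in> ?E" "(v, v) \<in> ?E" using eq assms unfolding equiv_def refl_on_def by blast+
  ultimately show ?thesis unfolding presented_mult_def word_class_def by blast
qed

end


section \<open>Thompson's group F\<close>

definition dyadic :: "real set" where
  "dyadic = {of_int m / 2 ^ n | (m :: int) (n :: nat). True}"

text \<open>
  The finite set \<open>D\<close> contains the singularities: on every interval without a point of \<open>D\<close> in
  its interior the map is affine.
\<close>

definition thompson_maps :: "(real \<Rightarrow> real) set" where
  "thompson_maps =
     {f \<in> Bij {0..1}. strict_mono_on {0..1} f \<and> continuous_on {0..1} f \<and>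
        (\<exists>D. finite D \<and> D \<subseteq> dyadic \<and>
           (\<forall>a b. 0 \<le> a \<and> a < b \<and> b \<le> 1 \<and> {a<..<b} \<inter> D = {} \<longrightarrow>
              (\<exists>(k :: int) c. \<forall>x \<in> {a..b}. f x = 2 powi k * x + c)))}"

definition thompson_F :: "(real \<Rightarrow> real) monoid" where
  "thompson_F = BijGroup {0..1} \<lparr>carrier := thompson_maps\<rparr>"

definition contains_as_subgroup :: "('g, 'm) monoid_scheme \<Rightarrow> ('h, 'n) monoid_scheme \<Rightarrow> bool" where
  "contains_as_subgroup G H \<longleftrightarrow> (\<exists>K. subgroup K G \<and> H \<cong> G\<lparr>carrier := K\<rparr>)"

end

theory Submission
  imports Defs
begin

text \<open>
  If \<open>w\<close> represents an idempotent, the Squier graph has a walk \<open>d\<close> from \<open>w\<close> to \<open>w w\<close>.  Reading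
  \<open>d\<close> as ``cut an interval into two halves'' sends every binary tree \<open>T\<close> with \<open>n\<close> leaves to a
  walk \<open>tree_walk w d T\<close> from \<open>w\<close> to \<open>w^n\<close>, and a pair \<open>(T, U)\<close> of trees with equally many
  leaves to the closed walk that goes along \<open>T\<close> and back along \<open>U\<close>.  Elements of \<open>F\<close> are given by
  such pairs too, with \<open>d\<close> the map that doubles the unit interval.  The embedding sends the element
  of \<open>F\<close> given by \<open>(T, U)\<close> to the class of the closed walk of \<open>(T, U)\<close>.

  On both sides, growing the same trees on corresponding leaves of \<open>T\<close> and \<open>U\<close> does not change the
  element.  In the diagram group this is \<open>pair_walk_graft\<close>; it rests on the fact that walks in
  disjoint parts of a word commute up to homotopy (\<open>exchange\<close>), which is what the 2-cells express
  for single edges.  Hence a product of two elements can be computed after the inner trees have been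
  grown to the same complete tree, and pairs multiply in the same way in both groups.

  What remains is that two pairs without a common expansion give different elements, for every
  presentation.  A walk from \<open>x\<close> to \<open>y\<close> acts on the real line by an increasing bijection that carries
  \<open>[0, |x|]\<close> to \<open>[0, |y|]\<close>, where an edge \<open>(p, u \<rightarrow> v, q)\<close> stretches an interval of length \<open>|u|\<close>
  linearly to length \<open>|v|\<close>.  This action is invariant under homotopy (\<open>path_map_homotopic\<close>), and the
  map of \<open>tree_walk w d T\<close> determines \<open>T\<close> (\<open>path_map_tree_walk_inj\<close>), because the map of \<open>d\<close>
  sends \<open>[0, |w|]\<close> to an interval twice as long, whatever \<open>d\<close> is.  So elements are equal if and only
  if their pairs have a common expansion (\<open>pair_class_eq_iff\<close>), a condition on trees alone.

  The same machinery, applied to the presentation \<open>\<langle>x | x = x x\<rangle>\<close> with its single relation as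
  \<open>d\<close>, yields the tree pair description of \<open>F\<close>: the action on the real line then produces exactly
  the piecewise linear maps in \<open>F\<close> (\<open>pair_map_in_thompson_maps\<close>, \<open>thompson_maps_pair_map\<close>).
\<close>

section \<open>Homotopy in the Squier complex\<close>

subsection \<open>Walks and their placement in a context\<close>

definition in_context :: "'a list \<Rightarrow> 'a list \<Rightarrow> 'a squier_edge list \<Rightarrow> 'a squier_edge list" where
  "in_context a b = map (\<lambda>(p, u, v, q). (a @ p, u, v, q @ b))"

lemma in_context_Nil [simp]: "in_context a b [] = []"
  and in_context_append [simp]: "in_context a b (p @ q) = in_context a b p @ in_context a b q"
  and in_context_empty [simp]: "in_context [] [] p = p"
  and in_context_in_context [simp]:
    "in_context a b (in_context a' b' p) = in_context (a @ a') (b' @ b) p"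
  by (auto simp: in_context_def intro!: map_idI)

lemma in_context_Cons [simp]:
  "in_context a b ((p, u, v, q) # es) = (a @ p, u, v, q @ b) # in_context a b es"
  by (simp add: in_context_def)

lemma inverse_walk_append [simp]:
  "inverse_walk f (p @ q) = inverse_walk f q @ inverse_walk f p"
  and inverse_walk_Nil [simp]: "inverse_walk f [] = []"
  by (simp_all add: inverse_walk_def)

lemma squier_inverse_simp [simp]: "squier_inverse (p, u, v, q) = (p, v, u, q)"
  by (simp add: squier_inverse_def)

lemma squier_inverse_squier_inverse [simp]: "squier_inverse (squier_inverse e) = e"
  by (cases e) simp

lemma inverse_walk_inverse_walk [simp]:
  "inverse_walk squier_inverse (inverse_walk squier_inverse p) = p"
  by (simp add: inverse_walk_def rev_map o_def)

context semigroup_presentation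
begin

sublocale squier: wf_digraph "squier_graph \<Sigma> R"
  by (rule wf_squier_graph)

abbreviation walk :: "'a list \<Rightarrow> 'a squier_edge list \<Rightarrow> 'a list \<Rightarrow> bool" where
  "walk \<equiv> squier.awalk"

abbreviation inv_walk :: "'a squier_edge list \<Rightarrow> 'a squier_edge list" where
  "inv_walk \<equiv> inverse_walk squier_inverse"

declare squier.awalk_append_iff [simp del]

lemma squier_verts [simp]: "verts (squier_graph \<Sigma> R) = nonempty_words \<Sigma>"
  by (simp add: squier_graph_def)

lemma relation_words:
  "(u, v) \<in> R \<Longrightarrow> u \<in> nonempty_words \<Sigma>" "(u, v) \<in> R \<Longrightarrow> v \<in> nonempty_words \<Sigma>"
  using relations_words by auto

lemma relation_nonempty [simp]: "([], v) \<notin> R" "(u, []) \<notin> R"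
  using relations_words by (auto simp: nonempty_words_def)

lemma walk_Nil_iff: "walk x [] y \<longleftrightarrow> x = y \<and> x \<in> nonempty_words \<Sigma>"
  by (auto simp: squier.awalk_Nil_iff)

lemma walk_Cons_iff:
  "walk x ((p, u, v, q) # es) y \<longleftrightarrow>
     p \<in> lists \<Sigma> \<and> q \<in> lists \<Sigma> \<and> ((u, v) \<in> R \<or> (v, u) \<in> R) \<and> x = p @ u @ q \<and>
     walk (p @ v @ q) es y"
  by (auto simp: squier.awalk_Cons_iff) (auto simp: squier_graph_def)

lemma walk_ends:
  assumes "walk x p y"
  shows "x \<in> nonempty_words \<Sigma>" "y \<in> nonempty_words \<Sigma>"
  using squier.awalk_hd_in_verts[OF assms] squier.awalk_last_in_verts[OF assms] by simp_all

lemma walk_appendE: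
  assumes "walk x (p @ q) y"
  obtains z where "walk x p z" "walk z q y"
  using assms squier.awalk_append_iff by blast

lemma squier_inverse_arc:
  assumes "e \<in> arcs (squier_graph \<Sigma> R)"
  shows "squier_inverse e \<in> arcs (squier_graph \<Sigma> R) \<and>
     tail (squier_graph \<Sigma> R) (squier_inverse e) = head (squier_graph \<Sigma> R) e \<and>
     head (squier_graph \<Sigma> R) (squier_inverse e) = tail (squier_graph \<Sigma> R) e"
  using assms by (cases e) (auto simp: squier_graph_def)

lemma walk_inv_walk: "walk x p y \<Longrightarrow> walk y (inv_walk p) x"
  using squier.awalk_inverse_walk squier_inverse_arc by blast

lemma walk_in_context:
  assumes "walk x p y" "a \<in> lists \<Sigma>" "b \<in> lists \<Sigma>"
  shows "walk (a @ x @ b) (in_context a b p) (a @ y @ b)"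
  using assms(1)
proof (induction p arbitrary: x)
  case Nil
  with assms show ?case by (auto simp: walk_Nil_iff nonempty_words_def)
next
  case (Cons e p)
  obtain p0 u v q0 where e: "e = (p0, u, v, q0)" by (cases e)
  from Cons.prems have "walk (p0 @ v @ q0) p y" by (simp add: e walk_Cons_iff)
  from Cons.IH[OF this] Cons.prems assms show ?case by (auto simp: e walk_Cons_iff)
qed


subsection \<open>Homotopy of walks with fixed end points\<close>

definition contractible :: "'a squier_edge list set" where
  "contractible = squier_cells \<Sigma> R \<union>
     {[e, squier_inverse e] | e. e \<in> arcs (squier_graph \<Sigma> R)}"

text \<open>
  Homotopy of walks between two possibly different vertices.  Walks that split \<open>w\<close> along a tree are
  not closed, and the restriction to closed walks would make every argument about them carry a
  return path.
\<close>

inductive homotopic :: "'a list \<Rightarrow> 'a list \<Rightarrow> 'a squier_edge list \<Rightarrow> 'a squier_edge list \<Rightarrow> bool"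
  for x y where
  homotopic_refl: "walk x p y \<Longrightarrow> homotopic x y p p"
| homotopic_contract: "walk x (p @ c @ q) y \<Longrightarrow> c \<in> contractible \<Longrightarrow> homotopic x y (p @ c @ q) (p @ q)"
| homotopic_sym: "homotopic x y p q \<Longrightarrow> homotopic x y q p"
| homotopic_trans [trans]: "homotopic x y p q \<Longrightarrow> homotopic x y q r \<Longrightarrow> homotopic x y p r"

lemma contractible_closed:
  assumes "c \<in> contractible" "walk x c y"
  shows "x = y"
proof -
  have "\<exists>z. walk z c z"
  proof (cases "c \<in> squier_cells \<Sigma> R")
    case True
    then show ?thesis using squier_cells_closed by (auto simp: closed_walks_def)
  next
    case False
    then obtain e where "c = [e, squier_inverse e]" "e \<in> arcs (squier_graph \<Sigma> R)"
      using assms by (auto simp: contractible_def)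
    then have "walk (tail (squier_graph \<Sigma> R) e) c (tail (squier_graph \<Sigma> R) e)"
      using squier_inverse_arc[of e] squier.tail_in_verts[of e]
      by (auto simp: squier.awalk_simps simp del: squier_verts)
    then show ?thesis by blast
  qed
  \<comment> \<open>the empty walk is closed at every vertex and would not determine its end points\<close>
  moreover have "c \<noteq> []"
    using assms(1) by (auto simp: contractible_def squier_cells_def inverse_walk_def)
  ultimately show ?thesis using assms(2)
    by (metis squier.awalk_ends)
qed

lemma homotopic_walks:
  "homotopic x y p q \<Longrightarrow> walk x p y \<and> walk x q y"
proof (induction rule: homotopic.induct)
  case (homotopic_contract p c q)
  obtain z z' where "walk x p z" "walk z c z'" "walk z' q y"
    using homotopic_contract(1) by (blast elim: walk_appendE)
  then show ?case
    using homotopic_contract contractible_closed squier.awalk_appendI by metis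
qed auto

lemma homotopic_append_context:
  assumes "homotopic x y p q" "walk x' a x" "walk y b y'"
  shows "homotopic x' y' (a @ p @ b) (a @ q @ b)"
  using assms(1)
proof (induction rule: homotopic.induct)
  case (homotopic_refl p)
  then show ?case
    using assms squier.awalk_appendI homotopic.homotopic_refl by metis
next
  case (homotopic_contract p c q)
  have "walk x' ((a @ p) @ c @ (q @ b)) y'"
    using squier.awalk_appendI[OF squier.awalk_appendI[OF assms(2) homotopic_contract(1)] assms(3)]
    by simp
  from homotopic.homotopic_contract[OF this homotopic_contract(2)] show ?case by simp
qed (blast intro: homotopic.intros)+

lemma homotopic_append:
  assumes "homotopic x y p p'" "homotopic y z q q'"
  shows "homotopic x z (p @ q) (p' @ q')"
proof -
  have w: "walk x p y" "walk x p' y" "walk y q z" "walk y q' z"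
    using assms homotopic_walks by blast+
  have "homotopic x z (p @ q) (p' @ q)"
    using homotopic_append_context[OF assms(1) _ w(3), of x "[]"] w walk_ends
    by (auto simp: walk_Nil_iff)
  also have "homotopic x z (p' @ q) (p' @ q')"
    using homotopic_append_context[OF assms(2) w(2), of "[]" z] w walk_ends
    by (auto simp: walk_Nil_iff)
  finally show ?thesis .
qed

lemma homotopic_inv_walk_right:
  assumes "walk x p y"
  shows "homotopic x x (p @ inv_walk p) []"
  using assms
proof (induction p arbitrary: x)
  case Nil
  then show ?case by (auto simp: walk_Nil_iff intro: homotopic_refl)
next
  case (Cons e p)
  then obtain z where z: "walk x [e] z" "walk z p y" using walk_appendE[of x "[e]" p y] by auto
  have inv: "inv_walk [e] = [squier_inverse e]" by (simp add: inverse_walk_def)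
  have "homotopic x x ([e] @ (p @ inv_walk p) @ [squier_inverse e]) ([] @ [e, squier_inverse e] @ [])"
    using homotopic_append_context[OF Cons.IH[OF z(2)] z(1)] walk_inv_walk[OF z(1)] inv by simp
  also have "homotopic x x ([] @ [e, squier_inverse e] @ []) ([] @ [])"
  proof (rule homotopic_contract)
    show "walk x ([] @ [e, squier_inverse e] @ []) x"
      using squier.awalk_appendI[OF z(1) walk_inv_walk[OF z(1)]] by (simp add: inv)
    show "[e, squier_inverse e] \<in> contractible"
      using z(1) unfolding contractible_def squier.awalk_Cons_iff by blast
  qed
  finally show ?case by (simp add: inverse_walk_def)
qed

lemma homotopic_inv_walk_left:
  assumes "walk x p y"
  shows "homotopic y y (inv_walk p @ p) []"
  using homotopic_inv_walk_right[OF walk_inv_walk[OF assms]] by simp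

text \<open>
  A 2-cell whose boundary is read as one side followed by the reverse of the other side lets one
  side be replaced by the other one.
\<close>

lemma homotopic_cell_sides:
  assumes s: "walk x s y" and t: "walk x t y" and "s @ inv_walk t \<in> squier_cells \<Sigma> R"
  shows "homotopic x y s t"
proof -
  have "homotopic x y ([] @ (s @ inv_walk t) @ t) ([] @ t)"
    using squier.awalk_appendI[OF squier.awalk_appendI[OF s walk_inv_walk[OF t]] t] assms(3)
    by (intro homotopic_contract) (auto simp: contractible_def)
  moreover have "homotopic x y (s @ (inv_walk t @ t)) (s @ [])"
    by (rule homotopic_append[OF homotopic_refl[OF s] homotopic_inv_walk_left[OF t]])
  ultimately show ?thesis by (auto intro: homotopic_sym homotopic_trans)
qed

lemma homotopic_cong_inv_walk:
  assumes "homotopic x y p q"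
  shows "homotopic y x (inv_walk p) (inv_walk q)"
proof -
  have w: "walk x p y" "walk x q y" using homotopic_walks[OF assms] by auto
  note wi = walk_inv_walk[OF w(1)] walk_inv_walk[OF w(2)]
  have "homotopic y x (inv_walk p) (inv_walk p @ q @ inv_walk q)"
    using homotopic_append[OF homotopic_refl[OF wi(1)] homotopic_sym[OF homotopic_inv_walk_right[OF w(2)]]]
    by simp
  also have "homotopic y x (inv_walk p @ q @ inv_walk q) (inv_walk p @ p @ inv_walk q)"
    by (rule homotopic_append_context[OF homotopic_sym[OF assms] wi])
  also have "homotopic y x (inv_walk p @ p @ inv_walk q) (inv_walk q)"
    using homotopic_append[OF homotopic_inv_walk_left[OF w(1)] homotopic_refl[OF wi(2)]] by simp
  finally show ?thesis .
qed

lemma in_context_squier_cell: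
  assumes "c \<in> squier_cells \<Sigma> R" "a \<in> lists \<Sigma>" "b \<in> lists \<Sigma>"
  shows "in_context a b c \<in> squier_cells \<Sigma> R"
proof -
  obtain p z q l1 r1 l2 r2 where c:
    "c = [(p, l1, r1, z @ l2 @ q), (p @ r1 @ z, l2, r2, q)] @
         inv_walk [(p @ l1 @ z, l2, r2, q), (p, l1, r1, z @ r2 @ q)]"
    "p \<in> lists \<Sigma>" "z \<in> lists \<Sigma>" "q \<in> lists \<Sigma>" "(l1, r1) \<in> R" "(l2, r2) \<in> R"
    using assms(1) unfolding squier_cells_def by blast
  show ?thesis
    unfolding squier_cells_def mem_Collect_eq
    by (rule exI[of _ "a @ p"], rule exI[of _ z], rule exI[of _ "q @ b"], intro exI)
      (use assms(2,3) c in \<open>auto simp: inverse_walk_def\<close>)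
qed

lemma homotopic_in_context:
  assumes "homotopic x y p q" "a \<in> lists \<Sigma>" "b \<in> lists \<Sigma>"
  shows "homotopic (a @ x @ b) (a @ y @ b) (in_context a b p) (in_context a b q)"
  using assms(1)
proof (induction rule: homotopic.induct)
  case (homotopic_refl p)
  then show ?case using assms walk_in_context homotopic.homotopic_refl by blast
next
  case (homotopic_contract p c q)
  have "in_context a b c \<in> contractible"
  proof (cases "c \<in> squier_cells \<Sigma> R")
    case True
    then have "in_context a b c \<in> squier_cells \<Sigma> R"
      by (rule in_context_squier_cell) (rule assms)+
    then show ?thesis by (simp add: contractible_def)
  next
    case False
    then obtain p u v q where "c = [(p, u, v, q), (p, v, u, q)]" "(p, u, v, q) \<in> arcs (squier_graph \<Sigma> R)"
      using homotopic_contract(2) by (auto simp: contractible_def)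
    then show ?thesis
      using assms(2,3) by (auto simp: contractible_def squier_graph_def)
  qed
  moreover have "walk (a @ x @ b) (in_context a b p @ in_context a b c @ in_context a b q) (a @ y @ b)"
    using walk_in_context[OF homotopic_contract(1) assms(2,3)] by simp
  ultimately show ?case using homotopic.homotopic_contract by auto
qed (blast intro: homotopic.intros)+

lemma homotopy_if_homotopic:
  assumes "homotopic x x p q"
  shows "(p, q) \<in> homotopy (squier_graph \<Sigma> R) squier_inverse (squier_cells \<Sigma> R) x"
  using assms
proof (induction rule: homotopic.induct)
  case (homotopic_refl p)
  then show ?case by (simp add: homotopy_def closed_walks_def)
next
  case (homotopic_contract p c q)
  have w: "walk x (p @ c @ q) x" "walk x (p @ q) x"
    using homotopic_walks[OF homotopic.homotopic_contract[OF homotopic_contract]] by auto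
  have "(p @ c @ q, p @ q) \<in> elementary_homotopy (squier_graph \<Sigma> R) squier_inverse (squier_cells \<Sigma> R) x"
    using w homotopic_contract(2)
    unfolding elementary_homotopy_def closed_walks_def contractible_def mem_Collect_eq by blast
  then show ?case using w by (auto simp: homotopy_def closed_walks_def)
next
  case (homotopic_sym p q)
  then show ?case using equiv_homotopy by (metis equiv_def symD)
next
  case (homotopic_trans p q r)
  then show ?case using equiv_homotopy by (metis equiv_def transD)
qed


subsection \<open>Disjoint walks commute\<close>

text \<open>
  The square for a walk \<open>p\<close> from \<open>a\<close> to \<open>b\<close> in the left part of a word and a walk \<open>q\<close> from \<open>c\<close> to
  \<open>d\<close> in the right part: doing \<open>p\<close> first or \<open>q\<close> first gives homotopic walks from \<open>a c\<close> to \<open>b d\<close>.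
\<close>

definition exchangeable ::
    "'a list \<Rightarrow> 'a list \<Rightarrow> 'a list \<Rightarrow> 'a list \<Rightarrow> 'a squier_edge list \<Rightarrow> 'a squier_edge list \<Rightarrow> bool" where
  "exchangeable a b c d p q \<longleftrightarrow>
     homotopic (a @ c) (b @ d)
       (in_context [] c p @ in_context b [] q) (in_context a [] q @ in_context [] d p)"

lemma inv_walk_in_context: "inv_walk (in_context a b p) = in_context a b (inv_walk p)"
  by (auto simp: inverse_walk_def in_context_def rev_map)

text \<open>
  The 2-cells only cover edges that apply relations in their given direction.  Reversing one pair of
  opposite sides of a commuting square leaves it commuting, which gives the other directions.
\<close>

lemma homotopic_square_inverse:
  assumes "homotopic x z (p @ q') (q @ p')"
    and w: "walk x p y" "walk x q y'" "walk y q' z" "walk y' p' z"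
  shows "homotopic y y' (inv_walk p @ q) (q' @ inv_walk p')"
proof -
  note wi = walk_inv_walk[OF w(1)] walk_inv_walk[OF w(4)]
  have "homotopic y y' (inv_walk p @ q) (inv_walk p @ q @ (p' @ inv_walk p'))"
    using homotopic_append[OF homotopic_refl[OF squier.awalk_appendI[OF wi(1) w(2)]]
        homotopic_sym[OF homotopic_inv_walk_right[OF w(4)]]] by simp
  also have "homotopic y y' (inv_walk p @ q @ (p' @ inv_walk p')) (inv_walk p @ (p @ q') @ inv_walk p')"
    using homotopic_append_context[OF homotopic_sym[OF assms(1)] wi] by simp
  also have "homotopic y y' (inv_walk p @ (p @ q') @ inv_walk p') (q' @ inv_walk p')"
    using homotopic_append[OF homotopic_inv_walk_left[OF w(1)]
        homotopic_refl[OF squier.awalk_appendI[OF w(3) wi(2)]]] by simp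
  finally show ?thesis .
qed

lemma exchangeable_walks:
  assumes "walk a p b" "walk c q d"
  shows "walk (a @ c) (in_context [] c p) (b @ c)" "walk (a @ c) (in_context a [] q) (a @ d)"
    "walk (b @ c) (in_context b [] q) (b @ d)" "walk (a @ d) (in_context [] d p) (b @ d)"
proof -
  have "{a, b, c, d} \<subseteq> lists \<Sigma>"
    using walk_ends[OF assms(1)] walk_ends[OF assms(2)] by (auto simp: nonempty_words_def)
  then show "walk (a @ c) (in_context [] c p) (b @ c)" "walk (a @ c) (in_context a [] q) (a @ d)"
    "walk (b @ c) (in_context b [] q) (b @ d)" "walk (a @ d) (in_context [] d p) (b @ d)"
    using walk_in_context[OF assms(1), of "[]"] walk_in_context[OF assms(2), of _ "[]"] by auto
qed

lemma exchangeable_inv_left: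
  assumes "exchangeable a b c d p q" "walk a p b" "walk c q d"
  shows "exchangeable b a c d (inv_walk p) q"
  using homotopic_square_inverse[OF assms(1)[unfolded exchangeable_def]]
    exchangeable_walks[OF assms(2,3)]
  by (simp add: exchangeable_def inv_walk_in_context)

lemma exchangeable_inv_right:
  assumes "exchangeable a b c d p q" "walk a p b" "walk c q d"
  shows "exchangeable a b d c p (inv_walk q)"
  using homotopic_square_inverse[OF homotopic_sym[OF assms(1)[unfolded exchangeable_def]]]
    exchangeable_walks[OF assms(2,3)]
  by (simp add: exchangeable_def inv_walk_in_context homotopic_sym)

lemma exchangeable_relations:
  assumes "(l1, r1) \<in> R" "(l2, r2) \<in> R"
    and words: "p1 \<in> lists \<Sigma>" "q1 \<in> lists \<Sigma>" "p2 \<in> lists \<Sigma>" "q2 \<in> lists \<Sigma>"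
  shows "exchangeable (p1 @ l1 @ q1) (p1 @ r1 @ q1) (p2 @ l2 @ q2) (p2 @ r2 @ q2)
    [(p1, l1, r1, q1)] [(p2, l2, r2, q2)]"
proof -
  let ?x = "p1 @ l1 @ (q1 @ p2) @ l2 @ q2" and ?y = "p1 @ r1 @ (q1 @ p2) @ r2 @ q2"
  let ?s = "[(p1, l1, r1, (q1 @ p2) @ l2 @ q2), (p1 @ r1 @ (q1 @ p2), l2, r2, q2)]"
  let ?t = "[(p1 @ l1 @ (q1 @ p2), l2, r2, q2), (p1, l1, r1, (q1 @ p2) @ r2 @ q2)]"
  have R: "l1 \<in> lists \<Sigma>" "r1 \<in> lists \<Sigma>" "l2 \<in> lists \<Sigma>" "r2 \<in> lists \<Sigma>" "r1 \<noteq> []"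
    using relation_words[OF assms(1)] relation_words[OF assms(2)] by (auto simp: nonempty_words_def)
  have s: "walk ?x ?s ?y" and t: "walk ?x ?t ?y"
    using assms R by (auto simp: walk_Cons_iff walk_Nil_iff nonempty_words_def)
  have "?s @ inv_walk ?t \<in> squier_cells \<Sigma> R"
    unfolding squier_cells_def mem_Collect_eq
    by (intro exI conjI, rule refl) (use assms in simp_all)
  from homotopic_cell_sides[OF s t this] show ?thesis by (simp add: exchangeable_def)
qed

lemma exchangeable_edges:
  assumes "walk a [e] b" "walk c [f] d"
  shows "exchangeable a b c d [e] [f]"
proof -
  obtain p1 u1 v1 q1 p2 u2 v2 q2 where ef: "e = (p1, u1, v1, q1)" "f = (p2, u2, v2, q2)"
    by (cases e, cases f)
  have e: "p1 \<in> lists \<Sigma>" "q1 \<in> lists \<Sigma>" "(u1, v1) \<in> R \<or> (v1, u1) \<in> R"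
      "a = p1 @ u1 @ q1" "b = p1 @ v1 @ q1"
    and f: "p2 \<in> lists \<Sigma>" "q2 \<in> lists \<Sigma>" "(u2, v2) \<in> R \<or> (v2, u2) \<in> R"
      "c = p2 @ u2 @ q2" "d = p2 @ v2 @ q2"
    using assms by (auto simp: ef walk_Cons_iff walk_Nil_iff)
  have pos: "exchangeable (p1 @ l1 @ q1) (p1 @ r1 @ q1) c d [(p1, l1, r1, q1)] [f]"
    if "(l1, r1) \<in> R" for l1 r1
    using f(3)
  proof
    assume "(u2, v2) \<in> R"
    with that e f show ?thesis by (auto simp: ef intro: exchangeable_relations)
  next
    assume *: "(v2, u2) \<in> R"
    have "exchangeable (p1 @ l1 @ q1) (p1 @ r1 @ q1) d c [(p1, l1, r1, q1)] [squier_inverse f]"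
      using that * e f by (auto simp: ef intro: exchangeable_relations)
    moreover have "walk (p1 @ l1 @ q1) [(p1, l1, r1, q1)] (p1 @ r1 @ q1)"
      using that e relation_words[OF that] by (auto simp: walk_Cons_iff walk_Nil_iff nonempty_words_def)
    moreover have "walk d [squier_inverse f] c"
      using walk_inv_walk[OF assms(2)] by (simp add: inverse_walk_def)
    ultimately have "exchangeable (p1 @ l1 @ q1) (p1 @ r1 @ q1) c d [(p1, l1, r1, q1)]
        (inv_walk [squier_inverse f])"
      by (rule exchangeable_inv_right)
    then show ?thesis by (simp add: inverse_walk_def)
  qed
  from e(3) show ?thesis
  proof
    assume "(u1, v1) \<in> R"
    from pos[OF this] e show ?thesis by (simp add: ef)
  next
    assume "(v1, u1) \<in> R"
    from pos[OF this] e have "exchangeable b a c d [squier_inverse e] [f]" by (simp add: ef)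
    moreover have "walk b [squier_inverse e] a"
      using walk_inv_walk[OF assms(1)] by (simp add: inverse_walk_def)
    ultimately have "exchangeable a b c d (inv_walk [squier_inverse e]) [f]"
      using assms(2) by (rule exchangeable_inv_left)
    then show ?thesis by (simp add: inverse_walk_def)
  qed
qed

lemma exchangeable_append_left:
  assumes "exchangeable a b c d p q" "exchangeable b b' c d p' q"
    and w: "walk a p b" "walk b p' b'" "walk c q d"
  shows "exchangeable a b' c d (p @ p') q"
proof -
  note ew = exchangeable_walks[OF w(1,3)] exchangeable_walks[OF w(2,3)]
  have "homotopic (a @ c) (b' @ d) (in_context [] c p @ in_context [] c p' @ in_context b' [] q)
      (in_context [] c p @ in_context b [] q @ in_context [] d p')"
    using homotopic_append[OF homotopic_refl[OF ew(1)] assms(2)[unfolded exchangeable_def]] .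
  also have "homotopic (a @ c) (b' @ d) (in_context [] c p @ in_context b [] q @ in_context [] d p')
      (in_context a [] q @ in_context [] d p @ in_context [] d p')"
    using homotopic_append[OF assms(1)[unfolded exchangeable_def] homotopic_refl[OF ew(8)]] by simp
  finally show ?thesis by (simp add: exchangeable_def)
qed

lemma exchangeable_append_right:
  assumes "exchangeable a b c d p q" "exchangeable a b d d' p q'"
    and w: "walk a p b" "walk c q d" "walk d q' d'"
  shows "exchangeable a b c d' p (q @ q')"
proof -
  note ew = exchangeable_walks[OF w(1,2)] exchangeable_walks[OF w(1,3)]
  have "homotopic (a @ c) (b @ d') (in_context [] c p @ in_context b [] q @ in_context b [] q')
      (in_context a [] q @ in_context [] d p @ in_context b [] q')"
    using homotopic_append[OF assms(1)[unfolded exchangeable_def] homotopic_refl[OF ew(7)]] by simp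
  also have "homotopic (a @ c) (b @ d') (in_context a [] q @ in_context [] d p @ in_context b [] q')
      (in_context a [] q @ in_context a [] q' @ in_context [] d' p)"
    using homotopic_append[OF homotopic_refl[OF ew(2)] assms(2)[unfolded exchangeable_def]] .
  finally show ?thesis by (simp add: exchangeable_def)
qed

lemma exchangeable_Nil:
  "walk c q d \<Longrightarrow> a \<in> nonempty_words \<Sigma> \<Longrightarrow> exchangeable a a c d [] q"
  "walk a p b \<Longrightarrow> c \<in> nonempty_words \<Sigma> \<Longrightarrow> exchangeable a b c c p []"
  using exchangeable_walks[of a "[]" a c q d] exchangeable_walks[of a p b c "[]" c]
  by (auto simp: exchangeable_def walk_Nil_iff intro: homotopic_refl)

lemma exchangeable_edge_walk:
  assumes "walk a [e] b" "walk c q d"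
  shows "exchangeable a b c d [e] q"
  using assms(2)
proof (induction q arbitrary: c)
  case Nil
  then show ?case using exchangeable_Nil(2)[OF assms(1)] by (auto simp: walk_Nil_iff)
next
  case (Cons f q)
  then obtain c' where c': "walk c [f] c'" "walk c' q d"
    using walk_appendE[of c "[f]" q d] by auto
  show ?case
    using exchangeable_append_right[OF exchangeable_edges[OF assms(1) c'(1)] Cons.IH[OF c'(2)] assms(1) c']
    by simp
qed

text \<open>
  A rectangular grid of commuting squares commutes: squares of single edges are glued along \<open>q\<close> for
  a single edge on the left, and then along \<open>p\<close>.
\<close>

lemma exchange:
  assumes "walk a p b" "walk c q d"
  shows "exchangeable a b c d p q"
  using assms(1)
proof (induction p arbitrary: a)
  case Nil
  then show ?case using exchangeable_Nil(1)[OF assms(2)] by (auto simp: walk_Nil_iff)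
next
  case (Cons e p)
  then obtain a' where a': "walk a [e] a'" "walk a' p b"
    using walk_appendE[of a "[e]" p b] by auto
  show ?case
    using exchangeable_append_left[OF exchangeable_edge_walk[OF a'(1) assms(2)] Cons.IH[OF a'(2)] a' assms(2)]
    by simp
qed

end


section \<open>Binary trees\<close>

datatype btree = Leaf | Node btree btree

primrec leaves :: "btree \<Rightarrow> nat" where
  "leaves Leaf = 1"
| "leaves (Node l r) = leaves l + leaves r"

primrec height :: "btree \<Rightarrow> nat" where
  "height Leaf = 0"
| "height (Node l r) = Suc (max (height l) (height r))"

primrec complete_tree :: "nat \<Rightarrow> btree" where
  "complete_tree 0 = Leaf"
| "complete_tree (Suc n) = Node (complete_tree n) (complete_tree n)"

text \<open>
  The list provides one tree for each leaf, from left to right.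
\<close>

primrec graft :: "btree \<Rightarrow> btree list \<Rightarrow> btree" where
  "graft Leaf ts = hd ts"
| "graft (Node l r) ts = Node (graft l (take (leaves l) ts)) (graft r (drop (leaves l) ts))"

lemma leaves_pos [simp]: "0 < leaves T"
  by (induction T) auto

lemma leaves_nonzero [simp]: "leaves T \<noteq> 0"
  using leaves_pos[of T] by simp

lemma leaves_complete_tree [simp]: "leaves (complete_tree n) = 2 ^ n"
  by (induction n) auto

lemma leaves_graft:
  "length ts = leaves T \<Longrightarrow> leaves (graft T ts) = (\<Sum>t\<leftarrow>ts. leaves t)"
proof (induction T arbitrary: ts)
  case Leaf
  then show ?case by (cases ts) auto
next
  case (Node l r)
  from Node.prems Node.IH(1)[of "take (leaves l) ts"] Node.IH(2)[of "drop (leaves l) ts"]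
  have "leaves (graft (Node l r) ts)
      = (\<Sum>t\<leftarrow>take (leaves l) ts @ drop (leaves l) ts. leaves t)"
    unfolding map_append sum_list_append by simp
  then show ?case by simp
qed

text \<open>
  Any two trees have a common expansion, and a complete tree of sufficient height serves as one.
\<close>

lemma graft_to_complete_tree:
  "height T \<le> n \<Longrightarrow> \<exists>ts. length ts = leaves T \<and> graft T ts = complete_tree n"
proof (induction T arbitrary: n)
  case Leaf
  show ?case by (rule exI[of _ "[complete_tree n]"]) simp
next
  case (Node l r)
  then obtain m where m: "n = Suc m" "height l \<le> m" "height r \<le> m"
    by (cases n) auto
  obtain ts us where "length ts = leaves l" "graft l ts = complete_tree m"
    "length us = leaves r" "graft r us = complete_tree m"
    using Node.IH m by blast
  then show ?case by (intro exI[of _ "ts @ us"]) (simp add: m(1))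
qed


text \<open>
  Two pairs with a common expansion.  The condition mentions no presentation, and it turns out to
  characterise equality of elements both in \<open>F\<close> and in the diagram group; comparing the two groups
  through it makes the embedding well defined and injective at once.
\<close>

definition same_pair :: "btree \<Rightarrow> btree \<Rightarrow> btree \<Rightarrow> btree \<Rightarrow> bool" where
  "same_pair T U T' U' \<longleftrightarrow>
     (\<exists>ts us. length ts = leaves T \<and> length us = leaves T' \<and>
        graft T ts = graft T' us \<and> graft U ts = graft U' us)"

lemma same_pair_swap:
  "leaves T = leaves U \<Longrightarrow> leaves T' = leaves U' \<Longrightarrow> same_pair T U T' U' \<longleftrightarrow> same_pair U T U' T'"
  by (auto simp: same_pair_def)

section \<open>Walks that split a word along a tree\<close>

definition word_power :: "'a list \<Rightarrow> nat \<Rightarrow> 'a list" where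
  "word_power w n = concat (replicate n w)"

lemma word_power_add: "word_power w (m + n) = word_power w m @ word_power w n"
  by (simp add: word_power_def replicate_add)

lemma word_power_simps [simp]:
  "word_power w 0 = []" "word_power w (Suc 0) = w" "word_power w (Suc n) = w @ word_power w n"
  by (simp_all add: word_power_def)

lemma length_word_power [simp]: "length (word_power w n) = n * length w"
  by (induction n) auto

primrec tree_walk :: "'a list \<Rightarrow> 'a squier_edge list \<Rightarrow> btree \<Rightarrow> 'a squier_edge list" where
  "tree_walk w d Leaf = []"
| "tree_walk w d (Node l r) =
     d @ in_context [] w (tree_walk w d l) @
     in_context (word_power w (leaves l)) [] (tree_walk w d r)"

primrec forest_walk :: "'a list \<Rightarrow> 'a squier_edge list \<Rightarrow> btree list \<Rightarrow> 'a squier_edge list" where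
  "forest_walk w d [] = []"
| "forest_walk w d (t # ts) =
     in_context [] (word_power w (length ts)) (tree_walk w d t) @
     in_context (word_power w (leaves t)) [] (forest_walk w d ts)"

lemma forest_walk_append:
  "forest_walk w d (ts @ us) =
     in_context [] (word_power w (length us)) (forest_walk w d ts) @
     in_context (word_power w (\<Sum>t\<leftarrow>ts. leaves t)) [] (forest_walk w d us)"
  by (induction ts) (simp_all add: word_power_add)

locale splitting = semigroup_presentation \<Sigma> R
  for \<Sigma> :: "'a set" and R :: "('a list \<times> 'a list) set" +
  fixes w :: "'a list" and d :: "'a squier_edge list"
  assumes splitting_walk: "walk w d (w @ w)"
begin

lemma w_word: "w \<in> nonempty_words \<Sigma>"
  using splitting_walk walk_ends by blast

lemma w_nonempty: "w \<noteq> []"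
  using w_word by (simp add: nonempty_words_def)

lemma word_power_lists: "word_power w n \<in> lists \<Sigma>"
  using w_word by (induction n) (auto simp: nonempty_words_def)

abbreviation tw where "tw \<equiv> tree_walk w d"
abbreviation fw where "fw \<equiv> forest_walk w d"
abbreviation wp where "wp \<equiv> word_power w"

lemma walk_tree_walk: "walk w (tw T) (wp (leaves T))"
proof (induction T)
  case Leaf
  then show ?case using w_word by (simp add: walk_Nil_iff)
next
  case (Node l r)
  have "walk (w @ w) (in_context [] w (tw l)) (wp (leaves l) @ w)"
    using walk_in_context[OF Node.IH(1), of "[]" w] word_power_lists[of 1] by simp
  moreover have "walk (wp (leaves l) @ w) (in_context (wp (leaves l)) [] (tw r))
      (wp (leaves l) @ wp (leaves r))"
    using walk_in_context[OF Node.IH(2), of "wp (leaves l)" "[]"] word_power_lists by simp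
  ultimately show ?case
    using splitting_walk squier.awalk_appendI unfolding tree_walk.simps leaves.simps word_power_add
    by blast
qed

lemma walk_forest_walk:
  "ts \<noteq> [] \<Longrightarrow> walk (wp (length ts)) (fw ts) (wp (\<Sum>t\<leftarrow>ts. leaves t))"
proof (induction ts)
  case (Cons t ts)
  have 1: "walk (w @ wp (length ts)) (in_context [] (wp (length ts)) (tw t))
      (wp (leaves t) @ wp (length ts))"
    using walk_in_context[OF walk_tree_walk, of "[]" "wp (length ts)"] word_power_lists by simp
  show ?case
  proof (cases "ts = []")
    case True
    then show ?thesis using 1 by simp
  next
    case False
    have "walk (wp (leaves t) @ wp (length ts)) (in_context (wp (leaves t)) [] (fw ts))
      (wp (leaves t) @ wp (\<Sum>t\<leftarrow>ts. leaves t))"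
      using walk_in_context[OF Cons.IH[OF False], of "wp (leaves t)" "[]"] word_power_lists by simp
    from squier.awalk_appendI[OF 1 this] show ?thesis by (simp add: word_power_add)
  qed
qed simp

text \<open>
  Splitting \<open>w\<close> along an expanded tree can be done in two stages, first along \<open>T\<close> and then in all
  parts.  At a node this requires the second stage of the left subtree to be postponed until the
  right subtree has been dealt with; the two take place in disjoint parts of the word.
\<close>

lemma tree_walk_graft:
  "length ts = leaves T \<Longrightarrow>
   homotopic w (wp (\<Sum>t\<leftarrow>ts. leaves t)) (tw (graft T ts)) (tw T @ fw ts)"
proof (induction T arbitrary: ts)
  case Leaf
  then obtain t where "ts = [t]" by (auto simp: length_Suc_conv)
  then show ?case using walk_tree_walk by (auto intro: homotopic_refl)
next
  case (Node l r)
  define us vs where "us = take (leaves l) ts" and "vs = drop (leaves l) ts"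
  have len: "length us = leaves l" "length vs = leaves r" and ts: "ts = us @ vs"
    using Node.prems by (auto simp: us_def vs_def)
  then have ne: "us \<noteq> []" "vs \<noteq> []" by auto
  let ?M = "\<Sum>t\<leftarrow>us. leaves t" and ?N = "\<Sum>t\<leftarrow>vs. leaves t"
  have gw: "leaves (graft l us) = ?M" by (simp add: leaves_graft len)
  have w: "w \<in> lists \<Sigma>" using word_power_lists[of 1] by simp
  have 1: "homotopic (w @ w) (wp ?M @ w) (in_context [] w (tw (graft l us)))
      (in_context [] w (tw l @ fw us))"
    using homotopic_in_context[OF Node.IH(1)[OF len(1)], of "[]" w] w by simp
  have 2: "homotopic (wp ?M @ w) (wp ?M @ wp ?N) (in_context (wp ?M) [] (tw (graft r vs)))
      (in_context (wp ?M) [] (tw r @ fw vs))"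
    using homotopic_in_context[OF Node.IH(2)[OF len(2)], of "wp ?M" "[]"] word_power_lists by simp
  have 3: "walk (w @ w) (in_context [] w (tw l)) (wp (leaves l) @ w)"
    using walk_in_context[OF walk_tree_walk, of "[]" w] w by simp
  have 4: "homotopic (wp (leaves l) @ w) (wp ?M @ wp (leaves r))
      (in_context [] w (fw us) @ in_context (wp ?M) [] (tw r))
      (in_context (wp (leaves l)) [] (tw r) @ in_context [] (wp (leaves r)) (fw us))"
    using exchange[OF walk_forest_walk[OF ne(1)] walk_tree_walk[of r]]
    by (simp add: exchangeable_def len)
  have 5: "walk (wp ?M @ wp (leaves r)) (in_context (wp ?M) [] (fw vs)) (wp ?M @ wp ?N)"
    using walk_in_context[OF walk_forest_walk[OF ne(2)], of "wp ?M" "[]"] word_power_lists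
    by (simp add: len)
  have "homotopic w (wp ?M @ wp ?N) (tw (graft (Node l r) ts))
      (d @ in_context [] w (tw l @ fw us) @ in_context (wp ?M) [] (tw r @ fw vs))"
    using homotopic_append[OF homotopic_refl[OF splitting_walk] homotopic_append[OF 1 2]]
    by (simp add: us_def[symmetric] vs_def[symmetric] gw)
  also have "homotopic w (wp ?M @ wp ?N)
      (d @ in_context [] w (tw l @ fw us) @ in_context (wp ?M) [] (tw r @ fw vs))
      (tw (Node l r) @ fw ts)"
    using homotopic_append[OF homotopic_refl[OF splitting_walk]
        homotopic_append[OF homotopic_refl[OF 3] homotopic_append[OF 4 homotopic_refl[OF 5]]]]
    by (simp add: ts forest_walk_append len)
  finally show ?case by (simp add: ts word_power_add)
qed


subsection \<open>Tree pairs as elements of the diagram group\<close>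

abbreviation pair_walk :: "btree \<Rightarrow> btree \<Rightarrow> 'a squier_edge list" where
  "pair_walk T U \<equiv> tw T @ inv_walk (tw U)"

lemma walk_pair_walk: "leaves T = leaves U \<Longrightarrow> walk w (pair_walk T U) w"
  using squier.awalk_appendI[OF walk_tree_walk[of T]] walk_inv_walk[OF walk_tree_walk[of U]] by simp

text \<open>
  The walk along the forest is followed immediately by its reverse, and cancels.
\<close>

lemma pair_walk_graft:
  assumes "leaves T = leaves U" "length ts = leaves T"
  shows "homotopic w w (pair_walk (graft T ts) (graft U ts)) (pair_walk T U)"
proof -
  have "ts \<noteq> []" using assms(2) by auto
  from walk_forest_walk[OF this] have f: "walk (wp (leaves T)) (fw ts) (wp (\<Sum>t\<leftarrow>ts. leaves t))"
    by (simp add: assms(2))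
  have "homotopic w w (pair_walk (graft T ts) (graft U ts)) ((tw T @ fw ts) @ inv_walk (tw U @ fw ts))"
    using homotopic_append[OF tree_walk_graft homotopic_cong_inv_walk[OF tree_walk_graft]] assms
    by simp
  also have "homotopic w w ((tw T @ fw ts) @ inv_walk (tw U @ fw ts)) (pair_walk T U)"
    using homotopic_append_context[OF homotopic_inv_walk_right[OF f] walk_tree_walk[of T]
        walk_inv_walk[OF walk_tree_walk[of U, folded assms(1)]]] by simp
  finally show ?thesis .
qed

lemma pair_walk_compose:
  assumes "leaves T = leaves U" "leaves U = leaves V"
  shows "homotopic w w (pair_walk T U @ pair_walk U V) (pair_walk T V)"
  using homotopic_append_context[OF homotopic_inv_walk_left[OF walk_tree_walk[of U]] _
      walk_inv_walk[OF walk_tree_walk[of V, folded assms(2)]], of w "tw T"]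
    walk_tree_walk[of T] assms by simp

end


section \<open>Piecewise linear maps induced by walks\<close>

text \<open>
  The action of an edge on the real line: the interval \<open>[a, a + s]\<close> is stretched to \<open>[a, a + t]\<close>,
  and everything to the right is translated.  Having maps of the whole line, rather than of
  intervals whose lengths depend on the words, lets the maps of consecutive edges
  be composed as they are.
\<close>

definition stretch :: "real \<Rightarrow> real \<Rightarrow> real \<Rightarrow> real \<Rightarrow> real" where
  "stretch a s t x =
     (if x \<le> a then x else if x \<le> a + s then a + (x - a) * t / s else x - s + t)"

lemma stretch_left: "x \<le> a \<Longrightarrow> stretch a s t x = x"
  and stretch_right: "0 < s \<Longrightarrow> a + s \<le> x \<Longrightarrow> stretch a s t x = x - s + t"
  by (auto simp: stretch_def)

lemma stretch_cases [case_names left middle right]: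
  fixes x a s :: real
  assumes "x \<le> a \<Longrightarrow> P" "a < x \<Longrightarrow> x \<le> a + s \<Longrightarrow> P" "a + s < x \<Longrightarrow> P"
  shows P
  using assms by fastforce

lemma stretch_middle_bounds:
  assumes "0 < s" "0 < t" "a < x" "x \<le> a + s"
  shows "a < stretch a s t x" "stretch a s t x \<le> a + t"
proof -
  have "(x - a) * t \<le> s * t" using assms by (intro mult_right_mono) auto
  then show "a < stretch a s t x" "stretch a s t x \<le> a + t"
    using assms by (auto simp: stretch_def field_simps)
qed

lemma stretch_inverse:
  assumes "0 < s" "0 < t"
  shows "stretch a t s (stretch a s t x) = x"
proof (cases x rule: stretch_cases[of _ a _ s])
  case middle
  from stretch_middle_bounds[OF assms this] middle assms show ?thesis
    by (simp add: stretch_def field_simps)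
qed (use assms in \<open>auto simp: stretch_def\<close>)

lemma stretch_translate: "stretch (b + a) s t x = b + stretch a s t (x - b)"
  by (auto simp: stretch_def)

text \<open>
  This is the relation imposed by a 2-cell: stretching two disjoint intervals can be done in
  either order, except that the right interval moves when the left one is stretched first.
\<close>

lemma stretch_commute:
  assumes "0 < s" "0 < t" "0 < s'" "0 < t'" "a + s \<le> b"
  shows "stretch (b - s + t) s' t' (stretch a s t x) = stretch a s t (stretch b s' t' x)"
proof (cases "x \<le> a + s")
  case True
  then have "stretch a s t x \<le> a + t"
    using stretch_middle_bounds(2)[OF assms(1,2), of a x] assms
    by (cases "x \<le> a") (auto simp: stretch_left)
  then show ?thesis using True assms by (simp add: stretch_left)
next
  case False
  have "a + s \<le> stretch b s' t' x"
  proof (cases x rule: stretch_cases[of _ b _ s'])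
    case middle
    from stretch_middle_bounds(1)[OF assms(3,4) this] assms show ?thesis by simp
  qed (use False assms in \<open>auto simp: stretch_def\<close>)
  then show ?thesis
    using False assms stretch_translate[of "t - s" b s' t' "x - s + t"]
    by (simp add: stretch_right algebra_simps)
qed

lemma strict_mono_stretch:
  assumes "0 < s" "0 < t"
  shows "strict_mono (stretch a s t)"
proof (rule strict_monoI)
  fix x y :: real assume "x < y"
  have *: "(x - a) * t / s < (y - a) * t / s" using assms \<open>x < y\<close> by (simp add: divide_strict_right_mono)
  show "stretch a s t x < stretch a s t y"
  proof (cases x rule: stretch_cases[of _ a _ s])
    case left
    have "0 < (y - a) * t / s" if "a < y" using that assms by simp
    with left \<open>x < y\<close> assms show ?thesis by (auto simp: stretch_def intro: add_le_less_mono[of x a 0, simplified])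
  next
    case middle
    with \<open>x < y\<close> assms * stretch_middle_bounds(2)[OF assms middle] show ?thesis by (auto simp: stretch_def)
  next
    case right
    with \<open>x < y\<close> assms show ?thesis by (auto simp: stretch_def)
  qed
qed

definition edge_map :: "'a squier_edge \<Rightarrow> real \<Rightarrow> real" where
  "edge_map = (\<lambda>(p, u, v, q). stretch (length p) (length u) (length v))"

primrec path_map :: "'a squier_edge list \<Rightarrow> real \<Rightarrow> real" where
  "path_map [] = id"
| "path_map (e # es) = path_map es \<circ> edge_map e"

lemma path_map_append: "path_map (p @ q) = path_map q \<circ> path_map p"
  by (induction p) auto

lemma edge_map_simp [simp]: "edge_map (p, u, v, q) = stretch (length p) (length u) (length v)"
  by (simp add: edge_map_def)

lemma path_map_in_context:
  fixes x :: real
  shows "path_map (in_context a b p) x = length a + path_map p (x - length a)"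
  by (induction p arbitrary: x) (auto simp: in_context_def stretch_translate)

context semigroup_presentation
begin

lemma relation_length_pos:
  assumes "(u, v) \<in> R \<or> (v, u) \<in> R"
  shows "0 < length u" "0 < length v"
  using assms relation_nonempty by auto

lemma path_map_Cons_arc:
  assumes "walk x (e # p) y"
  obtains a u v b where "e = (a, u, v, b)" "0 < length u" "0 < length v"
    "x = a @ u @ b" "walk (a @ v @ b) p y"
  using assms relation_length_pos by (cases e) (auto simp: walk_Cons_iff)

text \<open>
  Edges followed by their inverses act trivially, and so do boundaries of 2-cells because stretches
  of disjoint intervals commute.
\<close>

lemma path_map_contractible:
  assumes "walk x c y" "c \<in> contractible"
  shows "path_map c = id"
proof (cases "c \<in> squier_cells \<Sigma> R")
  case True
  then obtain p z q l1 r1 l2 r2 where c: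
    "c = [(p, l1, r1, z @ l2 @ q), (p @ r1 @ z, l2, r2, q)] @
         inv_walk [(p @ l1 @ z, l2, r2, q), (p, l1, r1, z @ r2 @ q)]"
    and "(l1, r1) \<in> R" "(l2, r2) \<in> R"
    unfolding squier_cells_def by blast
  then have pos: "0 < real (length l1)" "0 < real (length r1)" "0 < real (length l2)" "0 < real (length r2)"
    using relation_length_pos by auto
  have "path_map c t = t" for t
    using stretch_commute[OF pos, of "length p" "length (p @ l1 @ z)" t] pos
    by (simp add: c inverse_walk_def stretch_inverse add.commute add.left_commute)
  then show ?thesis by auto
next
  case False
  then obtain e where e: "c = [e, squier_inverse e]" using assms by (auto simp: contractible_def)
  from assms(1) obtain a u v b where "e = (a, u, v, b)" "0 < length u" "0 < length v"
    unfolding e by (rule path_map_Cons_arc)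
  then show ?thesis by (auto simp: e stretch_inverse)
qed

lemma path_map_homotopic:
  "homotopic x y p q \<Longrightarrow> path_map p = path_map q"
proof (induction rule: homotopic.induct)
  case (homotopic_contract p c q)
  then obtain z z' where "walk z c z'" by (blast elim: walk_appendE)
  from path_map_contractible[OF this homotopic_contract(2)] show ?case
    by (simp add: path_map_append)
qed auto

lemma path_map_inv_walk:
  assumes "walk x p y"
  shows "path_map (inv_walk p) (path_map p t) = t"
  using path_map_homotopic[OF homotopic_inv_walk_right[OF assms]]
  by (simp add: path_map_append fun_eq_iff)

lemma path_map_inv_walk':
  assumes "walk x p y"
  shows "path_map p (path_map (inv_walk p) t) = t"
  using path_map_inv_walk[OF walk_inv_walk[OF assms]] by simp

lemma path_map_left: "t \<le> 0 \<Longrightarrow> path_map p t = t"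
  by (induction p) (auto simp: edge_map_def stretch_left)

lemma path_map_right:
  fixes t :: real
  shows "walk x p y \<Longrightarrow> length x \<le> t \<Longrightarrow> path_map p t = t - length x + length y"
proof (induction p arbitrary: x t)
  case Nil
  then show ?case by (auto simp: walk_Nil_iff)
next
  case (Cons e p)
  from Cons.prems(1) obtain a u v b where *: "e = (a, u, v, b)" "0 < length u" "0 < length v"
    "x = a @ u @ b" "walk (a @ v @ b) p y" by (rule path_map_Cons_arc)
  then show ?case using Cons.prems(2) Cons.IH[OF *(5)] by (simp add: stretch_right)
qed

lemma strict_mono_path_map: "walk x p y \<Longrightarrow> strict_mono (path_map p)"
proof (induction p arbitrary: x)
  case Nil
  then show ?case by (simp add: strict_mono_def)
next
  case (Cons e p)
  from Cons.prems(1) obtain a u v b where *: "e = (a, u, v, b)" "0 < length u" "0 < length v"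
    "x = a @ u @ b" "walk (a @ v @ b) p y" by (rule path_map_Cons_arc)
  then show ?case using Cons.IH[OF *(5)] strict_mono_stretch
    by (simp add: strict_mono_def)
qed

end

context splitting
begin

lemma path_map_tree_walk_Node:
  fixes t :: real
  shows "path_map (tw (Node l r)) t =
     leaves l * length w + path_map (tw r) (path_map (tw l) (path_map d t) - leaves l * length w)"
  by (simp add: path_map_append path_map_in_context)

lemma path_map_tree_walk_end: "path_map (tw T) (length w) = leaves T * length w"
  using path_map_right[OF walk_tree_walk[of T], of "length w"] by simp

lemma leaves_eq_if_path_map_eq:
  assumes "path_map (tw T) = path_map (tw U)"
  shows "leaves T = leaves U"
  using path_map_tree_walk_end[of T] path_map_tree_walk_end[of U] w_nonempty
  unfolding assms of_nat_eq_iff by simp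

text \<open>
  The number of leaves is visible in the image of \<open>|w|\<close>.  For a node, the map of \<open>d\<close> can be
  cancelled.  What is left is the map of \<open>l\<close> followed by a translate of the map of \<open>r\<close>.  The latter
  is the identity up to the point \<open>leaves l * |w|\<close>, which is the image of \<open>|w|\<close>.  This point is
  therefore determined, and with it both parts.
\<close>

lemma path_map_tree_walk_inj:
  "path_map (tw T) = path_map (tw U) \<Longrightarrow> T = U"
proof (induction T arbitrary: U)
  case Leaf
  from leaves_eq_if_path_map_eq[OF this] show ?case by (cases U) (auto simp: add_is_1 eq_commute[of "Suc 0"])
next
  case (Node l r)
  have "leaves U \<noteq> 1"
    using leaves_eq_if_path_map_eq[OF Node.prems, symmetric] by (simp add: add_is_1)
  then obtain l' r' where U: "U = Node l' r'" by (cases U) auto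
  let ?m = "\<lambda>T. real (leaves T * length w)"
  have eq: "?m l + path_map (tw r) (path_map (tw l) t - ?m l)
      = ?m l' + path_map (tw r') (path_map (tw l') t - ?m l')" for t :: real
    using fun_cong[OF Node.prems, of "path_map (inv_walk d) t"] path_map_inv_walk'[OF splitting_walk]
    unfolding U path_map_tree_walk_Node by simp
  have m: "?m l = ?m l'"
    using eq[of "length w"] by (simp add: path_map_tree_walk_end path_map_left)
  \<comment> \<open>to the left of \<open>|w|\<close> the map of the right subtree is not felt, to the right of it everything
    is a translation by a known amount\<close>
  have "path_map (tw l) t = path_map (tw l') t" for t :: real
  proof (cases "t \<le> length w")
    case True
    have "path_map (tw T) t \<le> ?m T" for T
      using True path_map_tree_walk_end[of T] strict_mono_path_map[OF walk_tree_walk[of T]]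
      by (metis strict_mono_less_eq)
    then show ?thesis using eq[of t] m by (simp add: path_map_left)
  next
    case False
    then show ?thesis
      using path_map_right[OF walk_tree_walk[of l], of t] path_map_right[OF walk_tree_walk[of l'], of t] m
      by simp
  qed
  moreover have "path_map (tw r) t = path_map (tw r') t" for t :: real
    using eq[of "path_map (inv_walk (tw l)) (t + ?m l)"]
    unfolding calculation[symmetric] m[symmetric] path_map_inv_walk'[OF walk_tree_walk] by simp
  ultimately show ?case using Node.IH unfolding U by auto
qed


subsection \<open>Equality of tree pairs\<close>

lemma pair_walk_homotopic_if_same_pair:
  assumes "leaves T = leaves U" "leaves T' = leaves U'" "same_pair T U T' U'"
  shows "homotopic w w (pair_walk T U) (pair_walk T' U')"
proof -
  obtain ts us where *: "length ts = leaves T" "length us = leaves T'"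
    "graft T ts = graft T' us" "graft U ts = graft U' us"
    using assms(3) unfolding same_pair_def by blast
  show ?thesis
    using homotopic_trans[OF homotopic_sym[OF pair_walk_graft[OF assms(1) *(1)]]]
      pair_walk_graft[OF assms(2) *(2)] * by simp
qed

text \<open>
  Once both first trees have been grown to the same complete tree, they cancel, and the second trees
  have equal maps.
\<close>

lemma same_pair_if_path_map_eq:
  assumes leaves: "leaves T = leaves U" "leaves T' = leaves U'"
    and eq: "path_map (pair_walk T U) = path_map (pair_walk T' U')"
  shows "same_pair T U T' U'"
proof -
  define n where "n = max (height T) (height T')"
  obtain ts us where *: "length ts = leaves T" "length us = leaves T'"
    "graft T ts = complete_tree n" "graft T' us = complete_tree n"
    using graft_to_complete_tree[of T n] graft_to_complete_tree[of T' n] by (auto simp: n_def)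
  define V V' where "V = graft U ts" and "V' = graft U' us"
  have "path_map (pair_walk (complete_tree n) V) = path_map (pair_walk (complete_tree n) V')"
    using path_map_homotopic[OF pair_walk_graft[OF leaves(1) *(1)]]
      path_map_homotopic[OF pair_walk_graft[OF leaves(2) *(2)]] eq * by (simp add: V_def V'_def)
  then have eq': "path_map (inv_walk (tw V)) (path_map (tw (complete_tree n)) t)
      = path_map (inv_walk (tw V')) (path_map (tw (complete_tree n)) t)" for t :: real
    by (simp add: path_map_append fun_eq_iff)
  have inv: "path_map (inv_walk (tw V)) t = path_map (inv_walk (tw V')) t" for t :: real
    using eq'[of "path_map (inv_walk (tw (complete_tree n))) t"]
    by (simp add: path_map_inv_walk'[OF walk_tree_walk])
  have "path_map (tw V) t = path_map (tw V') t" for t :: real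
    using inv[of "path_map (tw V) t"] path_map_inv_walk[OF walk_tree_walk[of V], of t]
      path_map_inv_walk'[OF walk_tree_walk[of V']] by metis
  then have "V = V'" using path_map_tree_walk_inj by blast
  then show ?thesis using * unfolding same_pair_def V_def V'_def by metis
qed

end


section \<open>Thompson's group\<close>

text \<open>
  The diagram group over \<open>\<langle>x | x = x x\<rangle>\<close> with base point \<open>x\<close>, where a word is just a length and
  the walk from \<open>x\<close> to \<open>x x\<close> is the single edge given by the relation.  Its map doubles the unit
  interval, so \<open>dyadic_map T\<close> maps the \<open>i\<close>-th dyadic interval in the subdivision of \<open>[0, 1]\<close> along \<open>T\<close>
  linearly to \<open>[i, i + 1]\<close>.
\<close>

abbreviation caret :: "unit squier_edge list" where
  "caret \<equiv> [([], [()], [(), ()], [])]"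

lemma semigroup_presentation_thompson: "semigroup_presentation {()} {([()], [(), ()])}"
  by unfold_locales (auto simp: nonempty_words_def)

interpretation thompson: splitting "{()}" "{([()], [(), ()])}" "[()]" caret
proof -
  interpret semigroup_presentation "{()}" "{([()], [(), ()])}"
    by (rule semigroup_presentation_thompson)
  show "splitting {()} {([()], [(), ()])} [()] caret"
    by unfold_locales (auto simp: walk_Cons_iff walk_Nil_iff nonempty_words_def)
qed

definition dyadic_map :: "btree \<Rightarrow> real \<Rightarrow> real" where
  "dyadic_map T = path_map (tree_walk [()] caret T)"

definition dyadic_map_inv :: "btree \<Rightarrow> real \<Rightarrow> real" where
  "dyadic_map_inv T = path_map (thompson.inv_walk (tree_walk [()] caret T))"

lemma dyadic_map_inverse [simp]:
  "dyadic_map_inv T (dyadic_map T x) = x" "dyadic_map T (dyadic_map_inv T x) = x"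
  using thompson.path_map_inv_walk[OF thompson.walk_tree_walk]
    thompson.path_map_inv_walk'[OF thompson.walk_tree_walk]
  by (simp_all add: dyadic_map_def dyadic_map_inv_def)

lemma strict_mono_dyadic_map: "strict_mono (dyadic_map T)"
  "strict_mono (dyadic_map_inv T)"
  unfolding dyadic_map_def dyadic_map_inv_def
  using thompson.strict_mono_path_map thompson.walk_tree_walk thompson.walk_inv_walk by blast+

lemma dyadic_map_left: "x \<le> 0 \<Longrightarrow> dyadic_map T x = x"
  by (simp add: dyadic_map_def thompson.path_map_left)

lemma dyadic_map_right: "1 \<le> x \<Longrightarrow> dyadic_map T x = x - 1 + leaves T"
  using thompson.path_map_right[OF thompson.walk_tree_walk, of x T] by (simp add: dyadic_map_def)

lemma dyadic_map_bounds:
  assumes "x \<in> {0..1}"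
  shows "dyadic_map T x \<in> {0..real (leaves T)}"
proof -
  have "dyadic_map T 0 \<le> dyadic_map T x" "dyadic_map T x \<le> dyadic_map T 1"
    using assms by (simp_all add: strict_mono_less_eq[OF strict_mono_dyadic_map(1)])
  then show ?thesis by (simp add: dyadic_map_left dyadic_map_right)
qed

lemma dyadic_map_Leaf: "dyadic_map Leaf = id"
  by (simp add: dyadic_map_def)

lemma dyadic_map_Node:
  "dyadic_map (Node l r) x = leaves l + dyadic_map r (dyadic_map l (stretch 0 1 2 x) - leaves l)"
  using thompson.path_map_tree_walk_Node[of l r x] by (simp add: dyadic_map_def)

lemma dyadic_map_Node_left:
  assumes "0 \<le> x" "x \<le> 1 / 2"
  shows "dyadic_map (Node l r) x = dyadic_map l (2 * x)"
proof -
  have "stretch 0 1 2 x = 2 * x" using assms by (auto simp: stretch_def)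
  then show ?thesis
    using dyadic_map_bounds[of "2 * x" l] assms
    by (simp add: dyadic_map_Node dyadic_map_left)
qed

lemma dyadic_map_Node_right:
  assumes "1 / 2 \<le> x" "x \<le> 1"
  shows "dyadic_map (Node l r) x = leaves l + dyadic_map r (2 * x - 1)"
proof -
  have "stretch 0 1 2 x = 2 * x" using assms by (auto simp: stretch_def)
  then show ?thesis
    using assms by (simp add: dyadic_map_Node dyadic_map_right)
qed

lemma dyadic_map_complete_tree: "x \<in> {0..1} \<Longrightarrow> dyadic_map (complete_tree n) x = 2 ^ n * x"
proof (induction n arbitrary: x)
  case 0
  then show ?case by (simp add: dyadic_map_Leaf)
next
  case (Suc n)
  show ?case
  proof (cases "x \<le> 1 / 2")
    case True
    then show ?thesis using Suc.prems Suc.IH[of "2 * x"] by (simp add: dyadic_map_Node_left)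
  next
    case False
    then show ?thesis using Suc.prems Suc.IH[of "2 * x - 1"]
      by (simp add: dyadic_map_Node_right algebra_simps)
  qed
qed

lemma continuous_dyadic_map: "continuous_on UNIV (dyadic_map T)"
proof (induction T)
  case Leaf
  then show ?case by (simp add: dyadic_map_Leaf)
next
  case (Node l r)
  have "stretch 0 1 2 = (\<lambda>x. min (max x (2 * x)) (x + 1))"
    by (auto simp: stretch_def fun_eq_iff)
  then have "continuous_on UNIV (stretch 0 1 2)"
    by (auto intro!: continuous_intros)
  then have "continuous_on UNIV (\<lambda>x. leaves l + dyadic_map r (dyadic_map l (stretch 0 1 2 x) - leaves l))"
    by (intro continuous_intros continuous_on_compose2[OF Node.IH(1)] continuous_on_compose2[OF Node.IH(2)]) auto
  then show ?case by (simp add: dyadic_map_Node[abs_def])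
qed

lemma dyadic_of_int_div: "of_int m / 2 ^ n \<in> dyadic"
  unfolding dyadic_def by blast

lemma half_dyadic:
  assumes "x \<in> dyadic"
  shows "x / 2 \<in> dyadic" "(x + 1) / 2 \<in> dyadic"
proof -
  obtain m :: int and n :: nat where x: "x = of_int m / 2 ^ n" using assms by (auto simp: dyadic_def)
  have "x / 2 = of_int m / 2 ^ Suc n" "(x + 1) / 2 = of_int (m + 2 ^ n) / 2 ^ Suc n"
    by (simp_all add: x field_simps)
  then show "x / 2 \<in> dyadic" "(x + 1) / 2 \<in> dyadic"
    using dyadic_of_int_div by metis+
qed

text \<open>
  The condition on the singularities in the definition of \<open>F\<close>.
\<close>

definition affine_off :: "real set \<Rightarrow> (real \<Rightarrow> real) \<Rightarrow> bool" where
  "affine_off D f \<longleftrightarrow> (\<forall>a b. 0 \<le> a \<and> a < b \<and> b \<le> 1 \<and> {a<..<b} \<inter> D = {} \<longrightarrow>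
     (\<exists>(k :: int) c. \<forall>x \<in> {a..b}. f x = 2 powi k * x + c))"

text \<open>
  The singularities for a node are the midpoint and those of the two subtrees, scaled into the two
  halves of the unit interval.
\<close>

lemma dyadic_map_affine_off:
  "\<exists>D. finite D \<and> D \<subseteq> dyadic \<and> affine_off D (dyadic_map T)"
proof (induction T)
  case Leaf
  have "affine_off {} (dyadic_map Leaf)"
    by (auto simp: affine_off_def dyadic_map_Leaf intro!: exI[of _ "0 :: int"] exI[of _ "0 :: real"])
  then show ?case by blast
next
  case (Node l r)
  then obtain A B where A: "finite A" "A \<subseteq> dyadic" "affine_off A (dyadic_map l)"
    and B: "finite B" "B \<subseteq> dyadic" "affine_off B (dyadic_map r)" by blast
  let ?D = "insert (1 / 2) ((\<lambda>x. x / 2) ` A \<union> (\<lambda>x. (x + 1) / 2) ` B)"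
  have "1 / 2 \<in> dyadic" using dyadic_of_int_div[of 1 1] by simp
  then have "finite ?D" "?D \<subseteq> dyadic" using A B half_dyadic by auto
  moreover have "affine_off ?D (dyadic_map (Node l r))"
    unfolding affine_off_def
  proof (intro allI impI, elim conjE)
    fix a b :: real
    assume ab: "0 \<le> a" "a < b" "b \<le> 1" "{a<..<b} \<inter> ?D = {}"
    then have "1 / 2 \<notin> {a<..<b}" by blast
    then consider "b \<le> 1 / 2" | "1 / 2 \<le> a" by fastforce
    then show "\<exists>(k :: int) c. \<forall>x \<in> {a..b}. dyadic_map (Node l r) x = 2 powi k * x + c"
    proof cases
      case 1
      have "{2 * a<..<2 * b} \<inter> A = {}"
      proof (rule ccontr)
        assume "{2 * a<..<2 * b} \<inter> A \<noteq> {}"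
        then obtain y where "y \<in> A" "y \<in> {2 * a<..<2 * b}" by blast
        then have "y \<in> A" "y / 2 \<in> {a<..<b}" by auto
        then show False using ab(4) by blast
      qed
      then obtain k :: int and c where kc: "\<And>x. x \<in> {2 * a..2 * b} \<Longrightarrow> dyadic_map l x = 2 powi k * x + c"
        using A(3)[unfolded affine_off_def, rule_format, of "2 * a" "2 * b"] ab 1 by auto
      have "dyadic_map (Node l r) x = 2 powi (k + 1) * x + c" if "x \<in> {a..b}" for x
        using kc[of "2 * x"] that ab 1
        by (simp add: dyadic_map_Node_left power_int_add)
      then show ?thesis by blast
    next
      case 2
      have "{2 * a - 1<..<2 * b - 1} \<inter> B = {}"
      proof (rule ccontr)
        assume "{2 * a - 1<..<2 * b - 1} \<inter> B \<noteq> {}"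
        then obtain y where "y \<in> B" "y \<in> {2 * a - 1<..<2 * b - 1}" by blast
        then have "y \<in> B" "(y + 1) / 2 \<in> {a<..<b}" by auto
        then show False using ab(4) by blast
      qed
      then obtain k :: int and c where
        kc: "\<And>x. x \<in> {2 * a - 1..2 * b - 1} \<Longrightarrow> dyadic_map r x = 2 powi k * x + c"
        using B(3)[unfolded affine_off_def, rule_format, of "2 * a - 1" "2 * b - 1"] ab 2 by auto
      have "dyadic_map (Node l r) x = 2 powi (k + 1) * x + (c - 2 powi k + leaves l)"
        if "x \<in> {a..b}" for x
        using kc[of "2 * x - 1"] that ab 2
        by (simp add: dyadic_map_Node_right power_int_add algebra_simps)
      then show ?thesis by blast
    qed
  qed
  ultimately show ?case by blast
qed

subsection \<open>Tree pairs as piecewise linear maps\<close>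

text \<open>
  The inverse sits at the first tree because functions compose from right to left and walks
  from left to right: with this choice \<open>(T, U)\<close> times \<open>(U, V)\<close> is \<open>(T, V)\<close> for both.
\<close>

definition pair_map :: "btree \<Rightarrow> btree \<Rightarrow> real \<Rightarrow> real" where
  "pair_map T U = restrict (\<lambda>x. dyadic_map_inv T (dyadic_map U x)) {0..1}"

lemma path_map_pair_walk:
  "path_map (thompson.pair_walk U T) = (\<lambda>x. dyadic_map_inv T (dyadic_map U x))"
  by (auto simp: dyadic_map_inv_def dyadic_map_def path_map_append)

lemma pair_map_eq_iff:
  assumes "leaves T = leaves U" "leaves T' = leaves U'"
  shows "pair_map T U = pair_map T' U' \<longleftrightarrow> same_pair T U T' U'"
proof
  assume "same_pair T U T' U'"
  then have "same_pair U T U' T'" using same_pair_swap assms by blast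
  from thompson.path_map_homotopic[OF thompson.pair_walk_homotopic_if_same_pair[OF _ _ this]]
  show "pair_map T U = pair_map T' U'"
    using assms by (simp add: path_map_pair_walk pair_map_def)
next
  assume *: "pair_map T U = pair_map T' U'"
  \<comment> \<open>outside the unit interval closed walks at a word of length 1 act trivially\<close>
  have "path_map (thompson.pair_walk U T) x = path_map (thompson.pair_walk U' T') x" for x
  proof (cases "x \<in> {0..1}")
    case True
    with fun_cong[OF *, of x] show ?thesis by (simp add: path_map_pair_walk pair_map_def)
  next
    case False
    have "thompson.walk [()] (thompson.pair_walk U T) [()]" "thompson.walk [()] (thompson.pair_walk U' T') [()]"
      using assms thompson.walk_pair_walk by auto
    from thompson.path_map_right[OF this(1), of x] thompson.path_map_right[OF this(2), of x] False
    show ?thesis by (auto simp: thompson.path_map_left)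
  qed
  then have "path_map (thompson.pair_walk U T) = path_map (thompson.pair_walk U' T')" by blast
  from thompson.same_pair_if_path_map_eq[OF _ _ this] have "same_pair U T U' T'" using assms by simp
  then show "same_pair T U T' U'" using same_pair_swap assms by blast
qed

lemma pair_map_graft:
  assumes "leaves T = leaves U" "length ts = leaves T"
  shows "pair_map (graft T ts) (graft U ts) = pair_map T U"
proof -
  have "length ts = leaves U" using assms by simp
  from thompson.path_map_homotopic[OF thompson.pair_walk_graft[OF assms(1)[symmetric] this]]
  show ?thesis by (simp add: path_map_pair_walk pair_map_def)
qed

lemma pair_map_maps:
  assumes "leaves T = leaves U" "x \<in> {0..1}"
  shows "pair_map T U x \<in> {0..1}"
proof -
  have "dyadic_map_inv T 0 = 0" "dyadic_map_inv T (leaves U) = 1"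
    using dyadic_map_inverse(1)[of T 0] dyadic_map_inverse(1)[of T 1] assms(1)
    by (simp_all add: dyadic_map_left dyadic_map_right)
  moreover have "dyadic_map_inv T 0 \<le> dyadic_map_inv T (dyadic_map U x)"
    "dyadic_map_inv T (dyadic_map U x) \<le> dyadic_map_inv T (leaves U)"
    using dyadic_map_bounds[OF assms(2), of U]
    by (simp_all add: strict_mono_less_eq[OF strict_mono_dyadic_map(2)])
  ultimately show ?thesis using assms(2) by (simp add: pair_map_def)
qed

lemma pair_map_pair_map:
  assumes "leaves U = leaves V" "x \<in> {0..1}"
  shows "pair_map T U (pair_map U V x) = pair_map T V x"
  using pair_map_maps[OF assms] assms(2) by (simp add: pair_map_def)

lemma pair_map_same: "x \<in> {0..1} \<Longrightarrow> pair_map T T x = x"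
  by (simp add: pair_map_def)

lemma compose_pair_map:
  assumes "leaves U = leaves V"
  shows "compose {0..1} (pair_map T U) (pair_map U V) = pair_map T V"
proof
  fix x
  show "compose {0..1} (pair_map T U) (pair_map U V) x = pair_map T V x"
    using pair_map_pair_map[OF assms, of x T]
    by (cases "x \<in> {0..1}") (auto simp: compose_def restrict_apply pair_map_def[of T V] simp del: atLeastAtMost_iff)
qed

lemma bij_pair_map:
  assumes "leaves T = leaves U"
  shows "pair_map T U \<in> Bij {0..1}"
proof -
  have "bij_betw (pair_map T U) {0..1} {0..1}"
    using assms pair_map_pair_map[of T U _ U] pair_map_pair_map[of U T _ T]
      pair_map_maps[of T U] pair_map_maps[of U T]
    by (intro bij_betw_byWitness[where f' = "pair_map U T"])
      (auto simp del: atLeastAtMost_iff simp: pair_map_same)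
  then show ?thesis by (simp add: Bij_def pair_map_def)
qed

lemma dyadic_map_inv_complete_tree:
  assumes "x \<in> {0..2 ^ n}"
  shows "dyadic_map_inv (complete_tree n) x = x / 2 ^ n"
proof -
  have "dyadic_map (complete_tree n) (x / 2 ^ n) = x"
    using dyadic_map_complete_tree[of "x / 2 ^ n" n] assms by simp
  with dyadic_map_inverse(1)[of "complete_tree n" "x / 2 ^ n"] show ?thesis by (simp only:)
qed

lemma pair_map_complete_tree:
  assumes "leaves U = 2 ^ n" "x \<in> {0..1}"
  shows "pair_map (complete_tree n) U x = dyadic_map U x / 2 ^ n"
  using dyadic_map_bounds[OF assms(2), of U] assms
  by (simp add: pair_map_def dyadic_map_inv_complete_tree)

text \<open>
  After the first tree has been grown to a complete tree, its inverse map is division by a power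
  of 2, and the properties required are those of \<open>dyadic_map\<close>.
\<close>

lemma pair_map_in_thompson_maps:
  assumes "leaves T = leaves U"
  shows "pair_map T U \<in> thompson_maps"
proof -
  obtain n ts where ts: "length ts = leaves T" "graft T ts = complete_tree n"
    using graft_to_complete_tree by blast
  define V where "V = graft U ts"
  have V: "pair_map T U = pair_map (complete_tree n) V" "leaves V = 2 ^ n"
    using pair_map_graft[OF assms ts(1)] leaves_graft[OF ts(1)] leaves_graft[of ts U] ts assms
    by (simp_all add: V_def)
  let ?f = "pair_map (complete_tree n) V"
  have eq: "?f x = dyadic_map V x / 2 ^ n" if "x \<in> {0..1}" for x
    using pair_map_complete_tree[OF V(2) that] .
  obtain D where D: "finite D" "D \<subseteq> dyadic" "affine_off D (dyadic_map V)"
    using dyadic_map_affine_off by blast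
  have "\<exists>(k :: int) c. \<forall>x \<in> {a..b}. ?f x = 2 powi k * x + c"
    if ab: "0 \<le> a" "a < b" "b \<le> 1" "{a<..<b} \<inter> D = {}" for a b
  proof -
    obtain k :: int and c where kc: "\<And>x. x \<in> {a..b} \<Longrightarrow> dyadic_map V x = 2 powi k * x + c"
      using D(3) ab unfolding affine_off_def by blast
    have "?f x = 2 powi (k - int n) * x + c / 2 ^ n" if "x \<in> {a..b}" for x
      using kc[OF that] eq[of x] that ab by (simp add: power_int_diff add_divide_distrib)
    then show ?thesis by blast
  qed
  moreover have "strict_mono_on {0..1} ?f"
    using strict_mono_less[OF strict_mono_dyadic_map(1)[of V]]
    by (auto simp: strict_mono_on_def eq divide_strict_right_mono simp del: atLeastAtMost_iff)
  moreover have "continuous_on {0..1} ?f"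
  proof -
    have "continuous_on {0..1} (\<lambda>x. dyadic_map V x / 2 ^ n)"
      by (intro continuous_intros continuous_on_subset[OF continuous_dyadic_map]) auto
    then show ?thesis using eq by (subst continuous_on_cong[OF refl eq])
  qed
  moreover have "?f \<in> Bij {0..1}"
    using V(2) by (intro bij_pair_map) simp
  ultimately show ?thesis
    unfolding V(1) thompson_maps_def mem_Collect_eq
    by (intro conjI exI[of _ D] allI impI) (use D(1,2) in simp_all)
qed


subsection \<open>Every element of Thompson's group comes from a tree pair\<close>

text \<open>
  The \<open>i\<close>-th unit interval is subdivided along the \<open>i\<close>-th tree, after the earlier trees have moved it.
\<close>

lemma path_map_forest_walk:
  "i < length ts \<Longrightarrow> real i \<le> x \<Longrightarrow> x \<le> real i + 1 \<Longrightarrow>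
   path_map (forest_walk [()] caret ts) x
     = (\<Sum>t\<leftarrow>take i ts. leaves t) + dyadic_map (ts ! i) (x - i)"
proof (induction ts arbitrary: i x)
  case (Cons t ts)
  have step: "path_map (forest_walk [()] caret (t # ts)) x
      = leaves t + path_map (forest_walk [()] caret ts) (dyadic_map t x - leaves t)"
    by (simp add: path_map_append path_map_in_context dyadic_map_def)
  show ?case
  proof (cases i)
    case 0
    then show ?thesis
      using step dyadic_map_bounds[of x t] Cons.prems by (simp add: thompson.path_map_left)
  next
    case (Suc j)
    then show ?thesis
      using step Cons.prems Cons.IH[of j "x - 1"] by (simp add: dyadic_map_right algebra_simps)
  qed
qed simp

lemma dyadic_common_denominator:
  assumes "finite D" "D \<subseteq> dyadic"
  shows "\<exists>n::nat. \<forall>x\<in>D. \<exists>m::int. x = of_int m / 2 ^ n"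
  using assms
proof (induction D rule: finite_induct)
  case (insert y D)
  then obtain n :: nat where n: "\<And>x. x \<in> D \<Longrightarrow> \<exists>m::int. x = of_int m / 2 ^ n" by auto
  obtain k :: int and l :: nat where y: "y = of_int k / 2 ^ l"
    using insert.prems by (auto simp: dyadic_def)
  have "\<exists>m::int. x = of_int m / 2 ^ (n + l)" if "x \<in> insert y D" for x
  proof (cases "x = y")
    case True
    then have "x = of_int (k * 2 ^ n) / 2 ^ (n + l)" by (simp add: y power_add)
    then show ?thesis by blast
  next
    case False
    with that have "x \<in> D" by simp
    from n[OF this] obtain m :: int where "x = of_int m / 2 ^ n" by blast
    then have "x = of_int (m * 2 ^ l) / 2 ^ (n + l)" by (simp add: power_add)
    then show ?thesis by blast
  qed
  then show ?case by blast
qed auto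

lemma unit_interval_index:
  fixes x :: real
  assumes "0 \<le> x" "x \<le> real n" "0 < n"
  shows "\<exists>i<n. real i \<le> x \<and> x \<le> real i + 1"
proof (cases "x = n")
  case True
  then show ?thesis using assms by (intro exI[of _ "n - 1"]) auto
next
  case False
  then have "nat \<lfloor>x\<rfloor> < n" using assms by linarith
  moreover have "real (nat \<lfloor>x\<rfloor>) \<le> x" "x \<le> real (nat \<lfloor>x\<rfloor>) + 1" using assms by linarith+
  ultimately show ?thesis by blast
qed

lemma thompson_maps_endpoints:
  assumes "f \<in> thompson_maps"
  shows "f 0 = 0" "f 1 = 1"
proof -
  have b: "f ` {0..1} = {0..1}" and m: "strict_mono_on {0..1} f"
    using assms by (auto simp: thompson_maps_def Bij_def bij_betw_def)
  have "0 \<in> f ` {0..1}" "1 \<in> f ` {0..1}" unfolding b by auto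
  then obtain x y where x: "x \<in> {0..1}" "f x = 0" and y: "y \<in> {0..1}" "f y = 1" by fastforce
  have "f 0 \<in> f ` {0..1}" "f 1 \<in> f ` {0..1}" by auto
  then have "f 0 \<in> {0..1}" "f 1 \<in> {0..1}" unfolding b .
  moreover have "f 0 \<le> f x" "f y \<le> f 1"
    using x(1) y(1) by (auto intro!: strict_mono_on_leD[OF m])
  ultimately show "f 0 = 0" "f 1 = 1" using x y by auto
qed

text \<open>
  Cut \<open>[0, 1]\<close> into \<open>2^n\<close> equal parts so that \<open>f\<close> is affine with slope \<open>2^(k i)\<close> on the \<open>i\<close>-th part,
  and choose \<open>m\<close> so large that every image has length \<open>2^(k i) / 2^n = 2^(e i) / 2^m\<close> with
  \<open>e i \<ge> 0\<close>.  Cutting the \<open>i\<close>-th part further into \<open>2^(e i)\<close> equal pieces makes all images have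
  length \<open>1 / 2^m\<close>.  Since \<open>f\<close> fixes 0 and 1, these images are the pieces of the complete
  tree of height \<open>m\<close>.
\<close>

lemma thompson_maps_pair_map:
  assumes f: "f \<in> thompson_maps"
  shows "\<exists>T U. leaves T = leaves U \<and> f = pair_map T U"
proof -
  from f obtain D where D: "finite D" "D \<subseteq> dyadic" and affine: "affine_off D f"
    unfolding thompson_maps_def affine_off_def by blast
  obtain n :: nat where n: "\<And>x. x \<in> D \<Longrightarrow> \<exists>m::int. x = of_int m / 2 ^ n"
    using dyadic_common_denominator[OF D] by blast
  have "\<exists>(k :: int) c. \<forall>x \<in> {i / 2 ^ n..(i + 1) / 2 ^ n}. f x = 2 powi k * x + c"
    if "i < 2 ^ n" for i :: nat
  proof -
    have "{i / 2 ^ n<..<(i + 1) / 2 ^ n} \<inter> D = {}"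
    proof (rule ccontr)
      assume "{i / 2 ^ n<..<(i + 1) / 2 ^ n} \<inter> D \<noteq> {}"
      then obtain y where "y \<in> D" "y \<in> {i / 2 ^ n<..<(i + 1) / 2 ^ n}" by blast
      moreover from n[OF this(1)] obtain m :: int where "y = of_int m / 2 ^ n" by blast
      ultimately have "real_of_int (int i) < of_int m" "of_int m < real_of_int (int i + 1)"
        by (auto simp: divide_less_cancel)
      then show False unfolding of_int_less_iff by linarith
    qed
    moreover have "real (i + 1) \<le> real (2 ^ n)" using that unfolding of_nat_le_iff by simp
    ultimately show ?thesis
      using affine[unfolded affine_off_def, rule_format, of "i / 2 ^ n" "(i + 1) / 2 ^ n"]
      by (auto simp: divide_strict_right_mono)
  qed
  then obtain k :: "nat \<Rightarrow> int" and c where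
    kc: "\<And>i x. i < 2 ^ n \<Longrightarrow> x \<in> {i / 2 ^ n..(i + 1) / 2 ^ n} \<Longrightarrow> f x = 2 powi k i * x + c i"
    by metis
  \<comment> \<open>a crude upper bound of all the numbers \<open>n - k i\<close>\<close>
  define m where "m = (\<Sum>i<2 ^ n. nat (int n - k i))"
  define e where "e i = nat (k i + int m - int n)" for i
  have e: "2 ^ e i = 2 powi k i * 2 ^ m / (2 ^ n :: real)" if "i < 2 ^ n" for i
  proof -
    have "nat (int n - k i) \<le> m" unfolding m_def using that by (intro member_le_sum) auto
    then have "int (e i) = k i + int m - int n" by (simp add: e_def)
    then have "(2 :: real) ^ e i = 2 powi (k i + int m - int n)"
      by (metis power_int_of_nat)
    then show ?thesis by (simp add: power_int_diff power_int_add)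
  qed
  have at_grid: "2 ^ m * f (i / 2 ^ n) = (\<Sum>j<i. 2 ^ e j)" if "i \<le> 2 ^ n" for i :: nat
    using that
  proof (induction i)
    case 0
    then show ?case using thompson_maps_endpoints[OF f] by simp
  next
    case (Suc i)
    then have i: "i < 2 ^ n" by simp
    have "f (Suc i / 2 ^ n) = f (i / 2 ^ n) + 2 powi k i / 2 ^ n"
      using kc[OF i, of "i / 2 ^ n"] kc[OF i, of "Suc i / 2 ^ n"]
      by (simp add: divide_right_mono field_simps)
    then show ?case using Suc e[OF i] by (simp add: algebra_simps)
  qed
  define ts where "ts = map (\<lambda>i. complete_tree (e i)) [0..<2 ^ n]"
  define T where "T = graft (complete_tree n) ts"
  have len: "length ts = leaves (complete_tree n)" by (simp add: ts_def)
  have sum_take: "real (\<Sum>t\<leftarrow>take i ts. leaves t) = (\<Sum>j<i. 2 ^ e j)" if "i \<le> 2 ^ n" for i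
    using that by (simp add: ts_def take_map o_def interv_sum_list_conv_sum_set_nat atLeast0LessThan)
  have "real (leaves T) = 2 ^ m"
    using leaves_graft[OF len] sum_take[of "2 ^ n"] at_grid[of "2 ^ n"] thompson_maps_endpoints[OF f]
    by (simp add: T_def ts_def)
  then have "real (leaves T) = real (2 ^ m)" by simp
  then have T: "leaves T = 2 ^ m" unfolding of_nat_eq_iff .
  have "f x = pair_map (complete_tree m) T x" for x
  proof (cases "x \<in> {0..1}")
    case True
    have "dyadic_map T x = path_map (forest_walk [()] caret ts) (dyadic_map (complete_tree n) x)"
      using thompson.path_map_homotopic[OF thompson.tree_walk_graft[OF len]]
      by (simp add: dyadic_map_def T_def path_map_append)
    also have "dyadic_map (complete_tree n) x = 2 ^ n * x" using dyadic_map_complete_tree[OF True] .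
    finally have D: "dyadic_map T x = path_map (forest_walk [()] caret ts) (2 ^ n * x)" .
    obtain i where i: "i < 2 ^ n" "real i \<le> 2 ^ n * x" "2 ^ n * x \<le> real i + 1"
      using unit_interval_index[of "2 ^ n * x" "2 ^ n"] True by auto
    have "dyadic_map T x = (\<Sum>j<i. 2 ^ e j) + 2 ^ e i * (2 ^ n * x - i)"
      unfolding D using path_map_forest_walk[of i ts "2 ^ n * x"] sum_take[of i] i
        dyadic_map_complete_tree[of "2 ^ n * x - i" "e i"]
      by (simp add: ts_def)
    also have "\<dots> = 2 ^ m * f (i / 2 ^ n) + 2 ^ m * (2 powi k i * (x - i / 2 ^ n))"
      using at_grid[of i] i(1) e[OF i(1)] by (simp add: field_simps)
    also have "\<dots> = 2 ^ m * f x"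
      using kc[OF i(1), of "i / 2 ^ n"] kc[OF i(1), of x] i
      by (simp add: field_simps)
    finally show ?thesis using pair_map_complete_tree[OF T True] by simp
  next
    case False
    have "f \<in> extensional {0..1}" using f by (simp add: thompson_maps_def Bij_def)
    from extensional_arb[OF this False] False show ?thesis
      by (simp only: pair_map_def restrict_apply if_False)
  qed
  then have "f = pair_map (complete_tree m) T" by (rule ext)
  with T show ?thesis by (intro exI[of _ "complete_tree m"] exI[of _ T]) simp
qed


section \<open>Thompson's group inside the diagram group\<close>

context splitting
begin

definition pair_class :: "btree \<Rightarrow> btree \<Rightarrow> 'a squier_edge list set" where
  "pair_class T U =
     homotopy (squier_graph \<Sigma> R) squier_inverse (squier_cells \<Sigma> R) w `` {pair_walk T U}"

lemma pair_walk_closed: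
  "leaves T = leaves U \<Longrightarrow> pair_walk T U \<in> closed_walks (squier_graph \<Sigma> R) w"
  using walk_pair_walk by (simp add: closed_walks_def)

lemma pair_class_eqI:
  "homotopic w w (pair_walk T U) (pair_walk T' U') \<Longrightarrow> pair_class T U = pair_class T' U'"
  unfolding pair_class_def
  by (intro equiv_class_eq[OF equiv_homotopy] homotopy_if_homotopic)

text \<open>
  The action on the line is defined on classes of closed walks, so it separates elements of
  the diagram group.
\<close>

lemma homotopy_path_map:
  assumes "(p, q) \<in> homotopy (squier_graph \<Sigma> R) squier_inverse (squier_cells \<Sigma> R) w"
  shows "path_map p = path_map q"
proof -
  let ?E = "elementary_homotopy (squier_graph \<Sigma> R) squier_inverse (squier_cells \<Sigma> R) w"
  have *: "path_map p = path_map q" if "(p, q) \<in> ?E" for p q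
  proof -
    from that obtain a c b where "p = a @ c @ b" "q = a @ b" "walk w (a @ c @ b) w" "c \<in> contractible"
      unfolding elementary_homotopy_def closed_walks_def contractible_def by blast
    then show ?thesis using path_map_homotopic[OF homotopic_contract] by blast
  qed
  from assms have "(p, q) \<in> (?E \<union> ?E\<inverse>)\<^sup>*" by (simp add: homotopy_def)
  then show ?thesis
  proof (induction rule: rtrancl_induct)
    case (step y z)
    then show ?case using *[of y z] *[of z y] by auto
  qed simp
qed

lemma pair_class_eq_iff:
  assumes "leaves T = leaves U" "leaves T' = leaves U'"
  shows "pair_class T U = pair_class T' U' \<longleftrightarrow> same_pair T U T' U'"
proof
  assume "same_pair T U T' U'"
  from pair_class_eqI[OF pair_walk_homotopic_if_same_pair[OF assms this]]
  show "pair_class T U = pair_class T' U'" .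
next
  assume "pair_class T U = pair_class T' U'"
  from eq_equiv_class[OF this[unfolded pair_class_def] equiv_homotopy pair_walk_closed[OF assms(2)]]
  have "path_map (pair_walk T U) = path_map (pair_walk T' U')" by (rule homotopy_path_map)
  from same_pair_if_path_map_eq[OF assms this] show "same_pair T U T' U'" .
qed

lemma pair_class_mult:
  assumes "leaves T = leaves U" "leaves U = leaves V"
  shows "pair_class T U \<otimes>\<^bsub>diagram_group \<Sigma> R w\<^esub> pair_class U V = pair_class T V"
proof -
  have "pair_class T U \<otimes>\<^bsub>diagram_group \<Sigma> R w\<^esub> pair_class U V
      = homotopy (squier_graph \<Sigma> R) squier_inverse (squier_cells \<Sigma> R) w
          `` {pair_walk T U @ pair_walk U V}"
    unfolding pair_class_def diagram_group_def
    by (intro squier.fundamental_group_mult pair_walk_closed assms)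
  also have "\<dots> = pair_class T V"
    unfolding pair_class_def
    by (intro equiv_class_eq[OF equiv_homotopy] homotopy_if_homotopic pair_walk_compose assms)
  finally show ?thesis .
qed

lemma pair_class_carrier:
  "leaves T = leaves U \<Longrightarrow> pair_class T U \<in> carrier (diagram_group \<Sigma> R w)"
  unfolding pair_class_def diagram_group_def fundamental_group_def
  by (auto intro: quotientI pair_walk_closed)

lemma pair_class_one: "pair_class T T = \<one>\<^bsub>diagram_group \<Sigma> R w\<^esub>"
proof -
  interpret group "diagram_group \<Sigma> R w" by (rule group_diagram_group[OF w_word])
  show ?thesis
    using pair_class_mult[of T T T] pair_class_carrier[of T T] by (simp add: r_cancel_one')
qed

lemma pair_class_inv:
  assumes "leaves T = leaves U"
  shows "inv\<^bsub>diagram_group \<Sigma> R w\<^esub> pair_class T U = pair_class U T"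
proof -
  interpret group "diagram_group \<Sigma> R w" by (rule group_diagram_group[OF w_word])
  show ?thesis
    using pair_class_mult[of U T U] assms pair_class_carrier
    by (intro inv_equality) (auto simp: pair_class_one)
qed

definition pair_class_of :: "(real \<Rightarrow> real) \<Rightarrow> 'a squier_edge list set" where
  "pair_class_of f = (SOME g. \<exists>T U. leaves T = leaves U \<and> f = pair_map T U \<and> g = pair_class T U)"

lemma pair_class_of_pair_map:
  assumes "leaves T = leaves U"
  shows "pair_class_of (pair_map T U) = pair_class T U"
  unfolding pair_class_of_def
proof (rule some_equality)
  fix g
  assume "\<exists>T' U'. leaves T' = leaves U' \<and> pair_map T U = pair_map T' U' \<and> g = pair_class T' U'"
  then show "g = pair_class T U"
    using pair_map_eq_iff pair_class_eq_iff assms by metis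
qed (use assms in blast)

text \<open>
  Both pairs are expanded so that the second tree of the one and the first tree of the other become
  the same complete tree, which then cancels on both sides.
\<close>

lemma pair_class_of_hom:
  assumes "f \<in> thompson_maps" "g \<in> thompson_maps"
  shows "compose {0..1} f g \<in> thompson_maps"
    and "pair_class_of (compose {0..1} f g) = pair_class_of f \<otimes>\<^bsub>diagram_group \<Sigma> R w\<^esub> pair_class_of g"
proof -
  obtain T U where f: "leaves T = leaves U" "f = pair_map T U"
    using thompson_maps_pair_map[OF assms(1)] by blast
  obtain T' U' where g: "leaves T' = leaves U'" "g = pair_map T' U'"
    using thompson_maps_pair_map[OF assms(2)] by blast
  define n where "n = max (height U) (height T')"
  obtain ts us where ts: "length ts = leaves U" "graft U ts = complete_tree n"
    and us: "length us = leaves T'" "graft T' us = complete_tree n"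
    using graft_to_complete_tree[of U n] graft_to_complete_tree[of T' n] by (auto simp: n_def)
  define V W where "V = graft T ts" and "W = graft U' us"
  have len: "length ts = leaves T" "length us = leaves U'" using ts us f g by simp_all
  have l: "leaves V = leaves (complete_tree n)" "leaves (complete_tree n) = leaves W"
    unfolding V_def W_def
    using leaves_graft[OF ts(1)] leaves_graft[OF us(1)] leaves_graft[OF len(1)] leaves_graft[OF len(2)] ts(2) us(2)
    by simp_all
  have f': "f = pair_map V (complete_tree n)"
    using pair_map_graft[OF f(1) len(1)] by (simp add: f V_def ts)
  have g': "g = pair_map (complete_tree n) W"
    using pair_map_graft[OF g(1) us(1)] by (simp add: g W_def us)
  have fg: "compose {0..1} f g = pair_map V W"
    unfolding f' g' using compose_pair_map[OF l(2)] .
  show "compose {0..1} f g \<in> thompson_maps"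
    unfolding fg using l by (intro pair_map_in_thompson_maps) simp
  show "pair_class_of (compose {0..1} f g)
      = pair_class_of f \<otimes>\<^bsub>diagram_group \<Sigma> R w\<^esub> pair_class_of g"
    unfolding fg unfolding f' g'
    using l pair_class_mult[OF l] by (simp only: pair_class_of_pair_map)
qed

theorem diagram_group_contains_thompson_F:
  "contains_as_subgroup (diagram_group \<Sigma> R w) thompson_F"
proof -
  let ?G = "diagram_group \<Sigma> R w"
  let ?K = "pair_class_of ` thompson_maps"
  interpret group ?G by (rule group_diagram_group[OF w_word])
  have carrier: "pair_class_of f \<in> carrier ?G" if f: "f \<in> thompson_maps" for f
  proof -
    obtain T U where "leaves T = leaves U" "f = pair_map T U"
      using thompson_maps_pair_map[OF f] by blast
    then show ?thesis by (simp only: pair_class_of_pair_map pair_class_carrier)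
  qed
  have "subgroup ?K ?G"
  proof (rule subgroupI)
    show "?K \<subseteq> carrier ?G" using carrier by blast
    show "?K \<noteq> {}" using pair_map_in_thompson_maps[of Leaf Leaf] by auto
  next
    fix a assume "a \<in> ?K"
    then obtain f where f: "f \<in> thompson_maps" "a = pair_class_of f" by blast
    then obtain T U where TU: "leaves T = leaves U" "f = pair_map T U"
      using thompson_maps_pair_map by blast
    have "inv\<^bsub>?G\<^esub> a = pair_class_of (pair_map U T)"
      using TU f(2) by (simp only: pair_class_of_pair_map pair_class_inv)
    then show "inv\<^bsub>?G\<^esub> a \<in> ?K" using pair_map_in_thompson_maps[OF TU(1)[symmetric]] by blast
  next
    fix a b assume "a \<in> ?K" "b \<in> ?K"
    then obtain f g where fg: "f \<in> thompson_maps" "g \<in> thompson_maps"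
      "a = pair_class_of f" "b = pair_class_of g" by blast
    show "a \<otimes>\<^bsub>?G\<^esub> b \<in> ?K"
      unfolding fg(3,4) pair_class_of_hom(2)[OF fg(1,2), symmetric]
      by (intro imageI pair_class_of_hom(1) fg)
  qed
  moreover have "thompson_F \<cong> ?G\<lparr>carrier := ?K\<rparr>"
  proof -
    have "inj_on pair_class_of thompson_maps"
    proof (rule inj_onI)
      fix f g assume fg: "f \<in> thompson_maps" "g \<in> thompson_maps" "pair_class_of f = pair_class_of g"
      obtain T U where f: "leaves T = leaves U" "f = pair_map T U"
        using thompson_maps_pair_map[OF fg(1)] by blast
      obtain T' U' where g: "leaves T' = leaves U'" "g = pair_map T' U'"
        using thompson_maps_pair_map[OF fg(2)] by blast
      have "pair_class T U = pair_class T' U'"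
        using fg(3) f g by (simp only: pair_class_of_pair_map)
      then show "f = g" using pair_class_eq_iff[OF f(1) g(1)] pair_map_eq_iff[OF f(1) g(1)] f g by simp
    qed
    then have "bij_betw pair_class_of (carrier thompson_F) ?K"
      by (simp add: thompson_F_def bij_betw_def)
    moreover have "f \<otimes>\<^bsub>thompson_F\<^esub> g = compose {0..1} f g"
      if "f \<in> thompson_maps" "g \<in> thompson_maps" for f g
      using that by (simp add: thompson_F_def BijGroup_def thompson_maps_def)
    then have "pair_class_of \<in> hom thompson_F (?G\<lparr>carrier := ?K\<rparr>)"
      using pair_class_of_hom(2) by (auto simp: hom_def thompson_F_def)
    ultimately have "pair_class_of \<in> iso thompson_F (?G\<lparr>carrier := ?K\<rparr>)"
      by (simp add: iso_def)
    then show ?thesis by (auto simp: is_iso_def)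
  qed
  ultimately show ?thesis unfolding contains_as_subgroup_def by blast
qed

end

context semigroup_presentation
begin

text \<open>
  Being connected by a walk is a congruence that contains the relations, hence contains the smallest
  one.
\<close>

lemma walk_if_congruent:
  assumes "(u, v) \<in> presentation_congruence \<Sigma> R"
  shows "\<exists>p. walk u p v"
proof -
  let ?E = "{(u, v). \<exists>p. walk u p v}"
  have "equiv (nonempty_words \<Sigma>) ?E"
  proof (rule equivI)
    show "?E \<subseteq> nonempty_words \<Sigma> \<times> nonempty_words \<Sigma>" using walk_ends by blast
    have "walk x [] x" if "x \<in> nonempty_words \<Sigma>" for x using that by (simp add: walk_Nil_iff)
    then show "refl_on (nonempty_words \<Sigma>) ?E" by (auto simp: refl_on_def)
    show "sym ?E" using walk_inv_walk by (blast intro: symI)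
    show "trans ?E" using squier.awalk_appendI by (blast intro: transI)
  qed
  moreover have "\<exists>p. walk (x @ u) p (x @ v)" "\<exists>p. walk (u @ x) p (v @ x)"
    if "walk u p v" "x \<in> nonempty_words \<Sigma>" for u v p x
    using walk_in_context[OF that(1), of x "[]"] walk_in_context[OF that(1), of "[]" x] that(2)
    by (auto simp: nonempty_words_def)
  ultimately have "semigroup_congruence \<Sigma> ?E"
    unfolding semigroup_congruence_def by blast
  moreover have "walk u [([], u, v, [])] v" if "(u, v) \<in> R" for u v
    using that relation_words[OF that] by (simp add: walk_Cons_iff walk_Nil_iff)
  then have "R \<subseteq> ?E" by blast
  ultimately have "presentation_congruence \<Sigma> R \<subseteq> ?E"
    unfolding presentation_congruence_def by blast
  then show ?thesis using assms by blast
qed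

lemma splitting_walk_if_idempotent:
  assumes "w \<in> nonempty_words \<Sigma>" "is_idempotent \<Sigma> R (word_class \<Sigma> R w)"
  shows "\<exists>d. walk w d (w @ w)"
proof -
  have ww: "w @ w \<in> nonempty_words \<Sigma>" using assms(1) by (auto simp: nonempty_words_def)
  have "word_class \<Sigma> R w = word_class \<Sigma> R (w @ w)"
    using assms presented_mult_word_class[of w w] by (simp add: is_idempotent_def)
  moreover have "equiv (nonempty_words \<Sigma>) (presentation_congruence \<Sigma> R)"
    using semigroup_congruence_presentation by (simp add: semigroup_congruence_def)
  ultimately have "(w, w @ w) \<in> presentation_congruence \<Sigma> R"
    using ww unfolding word_class_def by (metis eq_equiv_class)
  then show ?thesis by (rule walk_if_congruent)
qed

end

theorem theorem25:
  fixes \<Sigma> :: "'a set" and R :: "('a list \<times> 'a list) set"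
  assumes "semigroup_presentation \<Sigma> R"
    and "\<exists>e. is_idempotent \<Sigma> R e"
  shows "(\<exists>w \<in> nonempty_words \<Sigma>. contains_as_subgroup (diagram_group \<Sigma> R w) thompson_F) \<and>
         (\<forall>w \<in> nonempty_words \<Sigma>. is_idempotent \<Sigma> R (word_class \<Sigma> R w) \<longrightarrow>
            contains_as_subgroup (diagram_group \<Sigma> R w) thompson_F)"
proof -
  interpret semigroup_presentation \<Sigma> R by (rule assms(1))
  have contains: "contains_as_subgroup (diagram_group \<Sigma> R w) thompson_F"
    if w: "w \<in> nonempty_words \<Sigma>" "is_idempotent \<Sigma> R (word_class \<Sigma> R w)" for w
  proof -
    obtain d where "walk w d (w @ w)" using splitting_walk_if_idempotent[OF w] by blast
    then interpret splitting \<Sigma> R w d by unfold_locales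
    show ?thesis by (rule diagram_group_contains_thompson_F)
  qed
  obtain e where e: "is_idempotent \<Sigma> R e" using assms(2) by blast
  then obtain w where "w \<in> nonempty_words \<Sigma>" "e = word_class \<Sigma> R w"
    unfolding is_idempotent_def presented_semigroup_def word_class_def by (auto elim: quotientE)
  with e contains show ?thesis by blast
qed

end
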